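(* For every integer $n \geq 1$, the independence complex of the hexagonal line tiling $H_{1\times 1\times n}$ is homotopy equivalent to a wedge of two $n$-dimensional spheres: $$\operatorname{Ind}\left(H_{1\times 1\times n}\right) \simeq \mathbb{S}^n \vee \mathbb{S}^n.$$
   Context: For a finite simple graph $G$, the independence complex $\operatorname{Ind}(G)$ is the simplicial complex on vertex set $V(G)$ whose faces are the independent sets of $G$ (sets of vertices no two of which are adjacent). For $n\ge 1$, the graph $H_{1\times 1\times n}$ (a row of $n$ hexagons) has vertex set $\{v^1_1,\dots,v^1_{2n+1}\}\sqcup\{v^2_1,\dots,v^2_{2n+1}\}$ and edges $\{v^j_r,v^j_{r+1}\}$ for $j\in\{1,2\}$ and $1\le r\le 2n$, together with $\{v^1_{2t-1},v^2_{2t-1}\}$ for $1\le t\le n+1$. $\simeq$ denotes homotopy equivalence and $\vee$ the wedge sum. *)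

theory Defs
  imports "HOL-Analysis.Analysis"
begin

section \<open>Graphs and independence complexes\<close>

definition finite_simple_graph :: "'a set \<Rightarrow> 'a set set \<Rightarrow> bool" where
  "finite_simple_graph V E \<longleftrightarrow> finite V \<and> (\<forall>e\<in>E. e \<subseteq> V \<and> card e = 2)"

definition independence_complex :: "'a set \<Rightarrow> 'a set set \<Rightarrow> 'a set set" where
  "independence_complex V E = {S. S \<subseteq> V \<and> (\<forall>u\<in>S. \<forall>v\<in>S. {u, v} \<notin> E)}"

text \<open>The vertex \<open>v\<^sup>j\<^sub>r\<close> is encoded as the pair \<open>(j, r)\<close>.\<close>

definition hex_line_verts :: "nat \<Rightarrow> (nat \<times> nat) set" where
  "hex_line_verts n = {1, 2} \<times> {1..2 * n + 1}"

definition hex_line_edges :: "nat \<Rightarrow> (nat \<times> nat) set set" where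
  "hex_line_edges n =
     {{(j, r), (j, r + 1)} | j r. j \<in> {1, 2} \<and> 1 \<le> r \<and> r \<le> 2 * n} \<union>
     {{(1, 2 * t - 1), (2, 2 * t - 1)} | t. 1 \<le> t \<and> t \<le> n + 1}"

lemma finite_simple_graph_hex_line:
  "finite_simple_graph (hex_line_verts n) (hex_line_edges n)"
  by (auto simp: finite_simple_graph_def hex_line_verts_def hex_line_edges_def)


section \<open>Geometric realization\<close>

text \<open>
  Points are given by their barycentric coordinates. A set \<open>K\<close> of faces is realized with the
  topology of pointwise convergence of the coordinates; when the vertex set of \<open>K\<close> is finite
  this is the usual (Euclidean, equivalently weak) topology. The empty face contributes no point,
  and neither does an infinite set in \<open>K\<close>, since the sum over it is \<open>0\<close> by convention.
\<close>

definition geometric_realization :: "'a set set \<Rightarrow> ('a \<Rightarrow> real) topology" where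
  "geometric_realization K =
     subtopology (powertop_real UNIV)
       {x. (\<forall>v. 0 \<le> x v) \<and> {v. x v \<noteq> 0} \<in> K \<and> (\<Sum>v | x v \<noteq> 0. x v) = 1}"


section \<open>Quotient spaces and wedge sums\<close>

definition quotient_topology :: "'a topology \<Rightarrow> ('a \<Rightarrow> 'b) \<Rightarrow> 'b topology" where
  "quotient_topology X q =
     topology (\<lambda>U. U \<subseteq> q ` topspace X \<and> openin X {x \<in> topspace X. q x \<in> U})"

lemma istopology_quotient_topology:
  "istopology (\<lambda>U. U \<subseteq> q ` topspace X \<and> openin X {x \<in> topspace X. q x \<in> U})"
proof -
  have 1: "{x \<in> topspace X. q x \<in> S \<inter> T} =
           {x \<in> topspace X. q x \<in> S} \<inter> {x \<in> topspace X. q x \<in> T}" for S T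
    by auto
  have 2: "{x \<in> topspace X. q x \<in> \<Union>\<K>} = (\<Union>S\<in>\<K>. {x \<in> topspace X. q x \<in> S})" for \<K>
    by auto
  show ?thesis
    unfolding istopology_def 1 2 by blast
qed

lemma openin_quotient_topology:
  "openin (quotient_topology X q) U \<longleftrightarrow>
     U \<subseteq> q ` topspace X \<and> openin X {x \<in> topspace X. q x \<in> U}"
  by (simp add: quotient_topology_def istopology_quotient_topology topology_inverse')

lemma topspace_quotient_topology: "topspace (quotient_topology X q) = q ` topspace X"
proof -
  have "{x \<in> topspace X. q x \<in> q ` topspace X} = topspace X"
    by auto
  then have "openin (quotient_topology X q) (q ` topspace X)"
    by (simp add: openin_quotient_topology)
  then show ?thesis
    by (meson openin_quotient_topology openin_subset openin_topspace subset_antisym)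
qed

lemma quotient_map_quotient_topology: "quotient_map X (quotient_topology X q) q"
  by (simp add: quotient_map_def topspace_quotient_topology openin_quotient_topology)

text \<open>
  The wedge sum of the spaces \<open>X i\<close> (\<open>i \<in> I\<close>) with base points \<open>p i\<close>: the disjoint union modulo
  the identification of all base points. Points are equivalence classes, that is, either the set
  of all base points or a singleton.
\<close>

definition wedge_sum :: "('i \<Rightarrow> 'a topology) \<Rightarrow> ('i \<Rightarrow> 'a) \<Rightarrow> 'i set \<Rightarrow> ('i \<times> 'a) set topology" where
  "wedge_sum X p I =
     quotient_topology (sum_topology X I)
       (\<lambda>z. let B = {(i, p i) | i. i \<in> I} in if z \<in> B then B else {z})"

text \<open>The base point of \<open>nsphere n\<close> is the first standard basis vector (cf. \<open>in_topspace_nsphere\<close>).\<close>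

definition sphere_basepoint :: "nat \<Rightarrow> real" where
  "sphere_basepoint = (\<lambda>i. if i = 0 then 1 else 0)"

definition wedge_of_spheres :: "nat \<Rightarrow> nat \<Rightarrow> (nat \<times> (nat \<Rightarrow> real)) set topology" where
  "wedge_of_spheres k n = wedge_sum (\<lambda>_. nsphere n) (\<lambda>_. sphere_basepoint) {..<k}"

end

theory Submission
  imports Defs
begin

text \<open>
  The main tool is an elementary collapse: if every face containing \<open>e\<close> can be extended by a vertex
  \<open>w \<notin> e\<close>, then removing all faces containing \<open>e\<close> does not change the homotopy type. It covers the
  deletion of a dominated vertex of a graph, the addition of an edge, and (read backwards) the
  replacement of a subcomplex that is a cone by the full simplex on its vertices.

  Write \<open>a\<^sub>r = (1, r)\<close> and \<open>b\<^sub>r = (2, r)\<close>. The edge \<open>a\<^sub>1 a\<^sub>3\<close> may be added to the graph because every neighbour of \<open>b\<^sub>2\<close>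
  is adjacent to \<open>a\<^sub>1\<close> or \<open>a\<^sub>3\<close>. Afterwards the faces avoiding \<open>a\<^sub>1\<close> and \<open>a\<^sub>3\<close> form a cone with apex \<open>a\<^sub>2\<close>, so the
  complex is a contractible piece, thickened to a full simplex, with cones from \<open>a\<^sub>1\<close> and \<open>a\<^sub>3\<close>
  attached over their links. Folding vertices along the ladder reduces the link of \<open>a\<^sub>1\<close> to the
  independence complex of the disjoint edges \<open>b\<^sub>2 b\<^sub>3\<close>, \<open>a\<^sub>4 a\<^sub>5\<close>, \<open>b\<^sub>6 b\<^sub>7\<close>, ... and the link of \<open>a\<^sub>3\<close> to that
  of \<open>b\<^sub>1 b\<^sub>2\<close>, \<open>b\<^sub>4 b\<^sub>5\<close>, \<open>a\<^sub>6 a\<^sub>7\<close>, ..., both of which are boundaries of cross-polytopes. Once the common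
  vertex \<open>b\<^sub>2\<close> has been replaced by \<open>a\<^sub>2\<close> in the second link, the same complex arises by thickening
  two cross-polytope boundaries that share a single vertex, and these form a wedge of two spheres.
\<close>

section \<open>Collapses of simplicial complexes\<close>


definition simplicial :: "'a set set \<Rightarrow> bool" where
  "simplicial K \<longleftrightarrow> (\<forall>\<sigma>\<in>K. finite \<sigma> \<and> Pow \<sigma> \<subseteq> K)"

lemma topspace_geometric_realization:
  "topspace (geometric_realization K) =
     {x. (\<forall>v. 0 \<le> x v) \<and> {v. x v \<noteq> 0} \<in> K \<and> (\<Sum>v | x v \<noteq> 0. x v) = 1}"
  by (simp add: geometric_realization_def)

lemma continuous_map_into_geometric_realization:
  assumes "\<And>v. continuous_map X euclideanreal (\<lambda>x. f x v)"
    and "f \<in> topspace X \<rightarrow> topspace (geometric_realization K)"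
  shows "continuous_map X (geometric_realization K) f"
  using assms
  by (simp add: geometric_realization_def continuous_map_in_subtopology
      continuous_map_componentwise_UNIV)

lemma continuous_map_geometric_realization_coordinate:
  "continuous_map (geometric_realization K) euclideanreal (\<lambda>x. x v)"
  unfolding geometric_realization_def
  by (blast intro: continuous_map_from_subtopology continuous_map_product_projection)

text \<open>Gives continuity of the smallest barycentric coordinate over a face, the amount of
  weight moved in a collapse.\<close>

lemma continuous_map_Min:
  assumes "finite I" "I \<noteq> {}" "\<And>i. i \<in> I \<Longrightarrow> continuous_map X euclideanreal (f i)"
  shows "continuous_map X euclideanreal (\<lambda>x. Min ((\<lambda>i. f i x) ` I))"
  using assms
proof (induction rule: finite_ne_induct)
  case (insert i I)
  then show ?case
    by (simp add: continuous_map_real_min)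
qed simp

text \<open>The smallest coordinate over \<open>e\<close> is subtracted on all of \<open>e\<close> and moved to \<open>w\<close>.\<close>

lemma homotopy_equivalent_collapse:
  assumes K: "simplicial K" and e: "finite e" "e \<noteq> {}" and w: "w \<notin> e"
    and cone: "\<And>\<sigma>. \<sigma> \<in> K \<Longrightarrow> e \<subseteq> \<sigma> \<Longrightarrow> insert w \<sigma> \<in> K"
  shows "geometric_realization K homotopy_equivalent_space
           geometric_realization {\<sigma>\<in>K. \<not> e \<subseteq> \<sigma>}"
proof -
  define L where "L = {\<sigma>\<in>K. \<not> e \<subseteq> \<sigma>}"
  let ?K = "geometric_realization K" and ?L = "geometric_realization L"
  define m where "m x = Min (x ` e)" for x :: "'a \<Rightarrow> real"
  \<comment> \<open>The values of \<open>d\<close> on \<open>insert w e\<close> add up to 0: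
    \<open>w\<close> gains \<open>card e\<close> and each vertex of \<open>e\<close> loses 1. Moving
    along \<open>d\<close> therefore preserves total weight 1.\<close>
  define d where "d v = (if v = w then real (card e) else if v \<in> e then -1 else 0)" for v
  define h where "h t x v = x v + t * m x * d v" for t :: real and x v
  have inside: "h t x \<in> topspace ?K" if x: "x \<in> topspace ?K" and t: "0 \<le> t" "t \<le> 1" for t x
  proof (cases "m x = 0")
    case True
    then have "h t x = x"
      by (auto simp: h_def)
    with x show ?thesis
      by simp
  next
    case False
    define \<sigma> where "\<sigma> = {v. x v \<noteq> 0}"
    have nn: "\<And>v. 0 \<le> x v" and sK: "\<sigma> \<in> K" and sum: "sum x \<sigma> = 1"
      using x by (auto simp: topspace_geometric_realization \<sigma>_def)
    have mle: "m x \<le> x v" if "v \<in> e" for v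
      using that e by (simp add: m_def)
    have "0 \<le> m x"
      using e nn by (simp add: m_def)
    then have pos: "0 < m x"
      using False by simp
    have sub: "e \<subseteq> \<sigma>"
      using mle pos by (force simp: \<sigma>_def)
    then have wK: "insert w \<sigma> \<in> K"
      using cone sK by blast
    then have fin: "finite (insert w \<sigma>)"
      using K by (auto simp: simplicial_def)
    have supp: "{v. h t x v \<noteq> 0} \<subseteq> insert w \<sigma>"
      using sub by (auto simp: h_def d_def \<sigma>_def)
    have "0 \<le> h t x v" for v
    proof -
      have "t * m x \<le> x v" if "v \<in> e"
        using mle[OF that] mult_left_le_one_le[of "m x" t] t pos by linarith
      then show ?thesis
        using nn[of v] t pos by (auto simp: h_def d_def)
    qed
    moreover have "{v. h t x v \<noteq> 0} \<in> K"
      using K wK supp by (auto simp: simplicial_def)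
    moreover have "(\<Sum>v | h t x v \<noteq> 0. h t x v) = 1"
    proof -
      have "(\<Sum>v | h t x v \<noteq> 0. h t x v) = (\<Sum>v\<in>insert w \<sigma>. h t x v)"
        using fin supp by (intro sum.mono_neutral_left) auto
      also have "\<dots> = sum x (insert w \<sigma>) + t * m x * sum d (insert w \<sigma>)"
        by (simp add: h_def sum.distrib sum_distrib_left)
      also have "sum x (insert w \<sigma>) = sum x \<sigma>"
        using fin by (intro sum.mono_neutral_right) (auto simp: \<sigma>_def)
      also have "sum d (insert w \<sigma>) = sum d (insert w e)"
        using fin sub by (intro sum.mono_neutral_right) (auto simp: d_def)
      also have "sum d (insert w e) = real (card e) + sum d e"
        using e w by (simp add: d_def)
      also have "sum d e = (\<Sum>v\<in>e. -1)"
        using w by (intro sum.cong) (auto simp: d_def)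
      finally show ?thesis
        using sum by simp
    qed
    ultimately show ?thesis
      by (simp add: topspace_geometric_realization)
  qed
  have inL: "h 1 x \<in> topspace ?L" if x: "x \<in> topspace ?K" for x
  proof -
    have "m x \<in> x ` e"
      unfolding m_def using e by (intro Min_in) auto
    then obtain v where v: "v \<in> e" "x v = m x"
      by force
    \<comment> \<open>At time 1 a vertex of \<open>e\<close> with the smallest weight has lost all
      of it, so \<open>e\<close> is no longer contained in the support.\<close>
    then have "h 1 x v = 0"
      using w by (auto simp: h_def d_def)
    then have "\<not> e \<subseteq> {v. h 1 x v \<noteq> 0}"
      using v by blast
    then show ?thesis
      using inside[OF x, of 1] by (simp add: topspace_geometric_realization L_def)
  qed
  \<comment> \<open>Some vertex of \<open>e\<close> already has weight 0, so \<open>m x = 0\<close>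
    and the homotopy is stationary on \<open>?L\<close>.\<close>
  have fixL: "h t x = x" if "x \<in> topspace ?L" for t x
  proof -
    have "\<not> e \<subseteq> {v. x v \<noteq> 0}"
      using that by (simp add: topspace_geometric_realization L_def)
    then obtain v where v: "v \<in> e" "x v = 0"
      by blast
    have "m x = 0"
      unfolding m_def
    proof (rule Min_eqI)
      show "0 \<in> x ` e"
        using v by force
    qed (use e that in \<open>auto simp: topspace_geometric_realization\<close>)
    then show ?thesis
      by (auto simp: h_def)
  qed
  have LK: "topspace ?L \<subseteq> topspace ?K"
    by (auto simp: topspace_geometric_realization L_def)
  have m_cont: "continuous_map ?K euclideanreal m"
    unfolding m_def using e
    by (intro continuous_map_Min) (auto intro: continuous_map_geometric_realization_coordinate)
  have h_cont: "continuous_map (prod_topology (top_of_set {0..1}) ?K) euclideanreal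
      (\<lambda>z. h (fst z) (snd z) v)" for v
  proof -
    have 1: "continuous_map (prod_topology (top_of_set {0..1}) ?K) euclideanreal fst"
      using continuous_map_fst continuous_map_into_fulltopology by blast
    have 2: "continuous_map (prod_topology (top_of_set {0..1}) ?K) euclideanreal (\<lambda>z. g (snd z))"
      if "continuous_map ?K euclideanreal g" for g
      using continuous_map_compose[OF continuous_map_snd that, of "top_of_set {0..1}"]
      by (simp add: o_def)
    show ?thesis
      unfolding h_def
      by (intro continuous_map_add continuous_map_real_mult 1
          2[OF m_cont] 2[OF continuous_map_geometric_realization_coordinate])
        simp
  qed
  have "homotopic_with (\<lambda>x. True) ?K ?K id (h 1)"
    unfolding homotopic_with_def
  proof (intro exI conjI)
    show "continuous_map (prod_topology (top_of_set {0..1}) ?K) ?K (\<lambda>z. h (fst z) (snd z))"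
      by (rule continuous_map_into_geometric_realization[OF h_cont]) (auto intro: inside)
  qed (auto simp: h_def)
  then have hom: "homotopic_with (\<lambda>x. True) ?K ?K (h 1) id"
    by (rule homotopic_with_symD)
  have "retraction_maps ?K ?L (h 1) id"
    unfolding retraction_maps_def
  proof (intro conjI)
    have "continuous_map ?K ?K (h 1)"
      using homotopic_with_imp_continuous_maps[OF hom] by blast
    then have "continuous_map ?K euclideanreal (\<lambda>x. h 1 x v)" for v
      using continuous_map_compose[OF _ continuous_map_geometric_realization_coordinate, of ?K K "h 1" v]
      by (simp add: o_def)
    then show "continuous_map ?K ?L (h 1)"
      by (rule continuous_map_into_geometric_realization) (use inL in auto)
    show "continuous_map ?L ?K id"
      by (rule continuous_map_into_geometric_realization)
        (use LK in \<open>auto intro: continuous_map_geometric_realization_coordinate\<close>)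
    show "\<forall>x\<in>topspace ?L. h 1 (id x) = x"
      by (simp add: fixL)
  qed
  then show ?thesis
    using hom deformation_retract_imp_homotopy_equivalent_space unfolding L_def by blast
qed

text \<open>The faces inside \<open>V\<close> form a cone with apex \<open>z\<close>, and the
  missing ones are added in pairs. A missing face \<open>e\<close> of least size avoids
  \<open>z\<close>; adjoining \<open>e\<close> and \<open>insert z e\<close> is a collapse read
  backwards, because no face of \<open>K\<close> contains \<open>e\<close>. The cone condition
  survives, so induction on the number of missing faces applies.\<close>

lemma homotopy_equivalent_Un_Pow:
  assumes "simplicial K" "{} \<in> K" "finite V" "z \<in> V"
    and "\<And>\<sigma>. \<sigma> \<in> K \<Longrightarrow> \<sigma> \<subseteq> V \<Longrightarrow> insert z \<sigma> \<in> K"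
  shows "geometric_realization K homotopy_equivalent_space geometric_realization (K \<union> Pow V)"
  using assms
proof (induction "card (Pow V - K)" arbitrary: K rule: less_induct)
  case less
  show ?case
  proof (cases "Pow V \<subseteq> K")
    case True
    then show ?thesis
      by (metis homotopy_equivalent_space_refl sup.absorb1)
  next
    case False
    then obtain \<sigma> where "\<sigma> \<in> Pow V - K"
      by blast
    then obtain e where e: "e \<in> Pow V - K"
      and min: "\<And>\<tau>. \<tau> \<in> Pow V - K \<Longrightarrow> card e \<le> card \<tau>"
      using ex_has_least_nat[of "\<lambda>\<tau>. \<tau> \<in> Pow V - K" \<sigma> card] by blast
    have finV: "finite \<tau>" if "\<tau> \<subseteq> V" for \<tau>
      using that less.prems finite_subset by blast
    have proper: "\<tau> \<in> K" if "\<tau> \<subset> e" for \<tau>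
    proof (rule ccontr)
      assume "\<tau> \<notin> K"
      then have "card e \<le> card \<tau>"
        using that e by (intro min) auto
      moreover have "card \<tau> < card e"
        using that e finV by (intro psubset_card_mono) auto
      ultimately show False
        by simp
    qed
    \<comment> \<open>Otherwise \<open>e - {z}\<close> lies in \<open>K\<close> by minimality, and
      the cone condition would put \<open>e\<close> itself into \<open>K\<close>.\<close>
    have ze: "z \<notin> e"
    proof
      assume "z \<in> e"
      then have "e - {z} \<in> K"
        by (intro proper) auto
      then have "insert z (e - {z}) \<in> K"
        using e by (intro less.prems) auto
      with \<open>z \<in> e\<close> e show False
        by (simp add: insert_absorb)
    qed
    have zK: "insert z e \<notin> K"
      using e less.prems(1) by (auto simp: simplicial_def)
    define K' where "K' = K \<union> {e, insert z e}"
    have sK': "simplicial K'"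
      unfolding simplicial_def
    proof (intro ballI conjI subsetI)
      fix \<sigma> \<tau> assume \<sigma>: "\<sigma> \<in> K'" and "\<tau> \<in> Pow \<sigma>"
      then have \<tau>: "\<tau> \<subseteq> \<sigma>"
        by simp
      consider "\<sigma> \<in> K" | "\<tau> \<subseteq> insert z e"
        using \<sigma> \<tau> by (auto simp: K'_def)
      then show "\<tau> \<in> K'"
      proof cases
        case 1
        then show ?thesis
          using less.prems(1) \<tau> by (auto simp: simplicial_def K'_def)
      next
        case 2
        \<comment> \<open>Apart from \<open>e\<close> and \<open>insert z e\<close>, a face of
          \<open>insert z e\<close> is a proper face of \<open>e\<close>, possibly with
          \<open>z\<close> added, and these are in \<open>K\<close> by minimality and the cone
          condition.\<close>
        show ?thesis
        proof (cases "\<tau> - {z} = e")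
          case True
          then show ?thesis
            by (auto simp: K'_def)
        next
          case False
          then have *: "\<tau> - {z} \<in> K"
            using 2 by (intro proper) auto
          then have "insert z (\<tau> - {z}) \<in> K"
            using 2 e by (intro less.prems) auto
          with * show ?thesis
            by (cases "z \<in> \<tau>") (auto simp: K'_def insert_absorb)
        qed
      qed
    next
      fix \<sigma> assume "\<sigma> \<in> K'"
      then show "finite \<sigma>"
        using less.prems(1) e finV by (auto simp: K'_def simplicial_def)
    qed
    have "geometric_realization K' homotopy_equivalent_space
            geometric_realization {\<sigma>\<in>K'. \<not> e \<subseteq> \<sigma>}"
    proof (rule homotopy_equivalent_collapse[OF sK' _ _ ze])
      show "finite e" "e \<noteq> {}"
        using e finV less.prems(2) by auto
      fix \<sigma> assume "\<sigma> \<in> K'" "e \<subseteq> \<sigma>"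
      moreover have "\<sigma> \<notin> K" if "e \<subseteq> \<sigma>" for \<sigma>
        using that e less.prems(1) by (auto simp: simplicial_def)
      ultimately show "insert z \<sigma> \<in> K'"
        by (auto simp: K'_def)
    qed
    also have "{\<sigma>\<in>K'. \<not> e \<subseteq> \<sigma>} = K"
      using e less.prems(1) by (auto simp: simplicial_def K'_def)
    finally have "geometric_realization K homotopy_equivalent_space geometric_realization K'"
      by (rule homotopy_equivalent_space_sym[THEN iffD1])
    also have "geometric_realization K' homotopy_equivalent_space
                 geometric_realization (K' \<union> Pow V)"
    proof (rule less.hyps)
      show "card (Pow V - K') < card (Pow V - K)"
        using e less.prems(3) by (intro psubset_card_mono) (auto simp: K'_def)
    qed (use sK' less.prems in \<open>auto simp: K'_def\<close>)
    also have "K' \<union> Pow V = K \<union> Pow V"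
      using e less.prems(4) by (auto simp: K'_def)
    finally show ?thesis .
  qed
qed


section \<open>Cross-polytopes and spheres\<close>

text \<open>If all the vertices are distinct, this is the boundary of the cross-polytope with
  antipodal pairs \<open>p i\<close>, \<open>q i\<close>, that is, the join of the two-point
  complexes on these pairs.\<close>

definition cross_polytope :: "'i set \<Rightarrow> ('i \<Rightarrow> 'a) \<Rightarrow> ('i \<Rightarrow> 'a) \<Rightarrow> 'a set set" where
  "cross_polytope I p q = {\<sigma>. \<sigma> \<subseteq> p ` I \<union> q ` I \<and> (\<forall>i\<in>I. p i \<notin> \<sigma> \<or> q i \<notin> \<sigma>)}"

text \<open>
  The positive and negative parts of \<open>u i\<close> are the weights of \<open>p i\<close> and \<open>q i\<close>. So \<open>sphere_basepoint\<close>
  is mapped to the vertex \<open>p 0\<close>.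
\<close>

definition cross_chart :: "nat \<Rightarrow> (nat \<Rightarrow> 'a) \<Rightarrow> (nat \<Rightarrow> 'a) \<Rightarrow> (nat \<Rightarrow> real) \<Rightarrow> 'a \<Rightarrow> real" where
  "cross_chart n p q u v =
     (\<Sum>i\<le>n. (if v = p i then max (u i) 0 else 0) + (if v = q i then max (- u i) 0 else 0))
       / (\<Sum>i\<le>n. \<bar>u i\<bar>)"

lemma topspace_nsphere:
  "topspace (nsphere n) = {u. (\<Sum>i\<le>n. (u i)\<^sup>2) = 1 \<and> (\<forall>i>n. u i = 0)}"
  by (simp add: nsphere)

text \<open>The sphere is closed in a product of intervals, which is compact by Tychonoff.
  Compactness later makes a continuous bijection from the wedge a homeomorphism.\<close>

lemma compact_space_nsphere: "compact_space (nsphere n)"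
proof -
  let ?S = "{u::nat \<Rightarrow> real. (\<Sum>i\<le>n. (u i)\<^sup>2) = 1 \<and> (\<forall>i>n. u i = 0)}"
  let ?C = "Pi\<^sub>E UNIV (\<lambda>_. {-1..1}) :: (nat \<Rightarrow> real) set"
  have "compactin (powertop_real UNIV) ?C"
    by (simp add: compactin_PiE)
  moreover have "?S \<subseteq> ?C"
  proof clarify
    fix u :: "nat \<Rightarrow> real" assume u: "(\<Sum>i\<le>n. (u i)\<^sup>2) = 1" "\<forall>i>n. u i = 0"
    have "\<bar>u i\<bar> \<le> 1" for i
    proof (cases "i \<le> n")
      case True
      then have "(u i)\<^sup>2 \<le> (\<Sum>i\<le>n. (u i)\<^sup>2)"
        by (intro member_le_sum) auto
      with u show ?thesis
        by (simp add: abs_square_le_1)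
    qed (use u in simp)
    then show "u \<in> ?C"
      by (auto simp: abs_le_iff minus_le_iff)
  qed
  moreover have "closedin (powertop_real UNIV) ?S"
  proof -
    have "closed {u::nat \<Rightarrow> real. (\<Sum>i\<le>n. (u i)\<^sup>2) = 1}"
      by (rule closed_Collect_eq[OF continuous_on_sum[OF continuous_on_power
              [OF continuous_on_product_coordinates]] continuous_on_const])
    moreover have "closed {u::nat \<Rightarrow> real. u i = 0}" for i
      by (rule closed_Collect_eq[OF continuous_on_product_coordinates continuous_on_const])
    then have "closed (\<Inter>i\<in>{n<..}. {u::nat \<Rightarrow> real. u i = 0})"
      by blast
    moreover have "?S = {u. (\<Sum>i\<le>n. (u i)\<^sup>2) = 1} \<inter> (\<Inter>i\<in>{n<..}. {u. u i = 0})"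
      by blast
    ultimately have "closed ?S"
      by (simp only: closed_Int)
    then show ?thesis
      by (simp only: closed_closedin euclidean_product_topology)
  qed
  ultimately show ?thesis
    unfolding nsphere by (rule compact_space_subtopology[OF closed_compactin])
qed

text \<open>The denominator in \<open>cross_chart\<close> does not vanish on the sphere.\<close>

lemma sum_abs_pos_nsphere:
  assumes "u \<in> topspace (nsphere n)"
  shows "0 < (\<Sum>i\<le>n. \<bar>u i\<bar>)"
proof -
  have "\<exists>i\<le>n. u i \<noteq> 0"
  proof (rule ccontr)
    assume "\<not> (\<exists>i\<le>n. u i \<noteq> 0)"
    then have "(\<Sum>i\<le>n. (u i)\<^sup>2) = 0"
      by simp
    with assms show False
      by (simp add: topspace_nsphere)
  qed
  then obtain i where "i \<le> n" "u i \<noteq> 0"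
    by blast
  then show ?thesis
    by (intro sum_pos2[of _ i]) auto
qed

lemma continuous_map_cross_chart:
  "continuous_map (nsphere n) euclideanreal (\<lambda>u. cross_chart n p q u v)"
proof -
  have if_cont: "continuous_map (nsphere n) euclideanreal (\<lambda>u. if P then f u else 0)"
    if "continuous_map (nsphere n) euclideanreal f" for P f
    using that by simp
  show ?thesis
    unfolding cross_chart_def
    by (intro if_cont continuous_map_real_divide continuous_map_sum continuous_map_add
        continuous_map_real_abs continuous_map_real_max continuous_map_minus
        continuous_map_nsphere_projection continuous_map_const[THEN iffD2])
      (use sum_abs_pos_nsphere in fastforce)+
qed

context
  fixes n :: nat and p q :: "nat \<Rightarrow> 'a"
  assumes inj_p: "inj_on p {..n}" and inj_q: "inj_on q {..n}"
    and disj: "p ` {..n} \<inter> q ` {..n} = {}"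
begin

lemma cross_chart_p:
  assumes "j \<le> n"
  shows "cross_chart n p q u (p j) = max (u j) 0 / (\<Sum>i\<le>n. \<bar>u i\<bar>)"
proof -
  have "(\<Sum>i\<le>n. (if p j = p i then max (u i) 0 else 0) + (if p j = q i then max (- u i) 0 else 0))
      = (\<Sum>i\<le>n. if i = j then max (u i) 0 else 0)"
    using assms inj_p disj by (intro sum.cong) (auto dest: inj_onD)
  then show ?thesis
    using assms by (simp add: cross_chart_def)
qed

lemma cross_chart_q:
  assumes "j \<le> n"
  shows "cross_chart n p q u (q j) = max (- u j) 0 / (\<Sum>i\<le>n. \<bar>u i\<bar>)"
proof -
  have "(\<Sum>i\<le>n. (if q j = p i then max (u i) 0 else 0) + (if q j = q i then max (- u i) 0 else 0))
      = (\<Sum>i\<le>n. if i = j then max (- u i) 0 else 0)"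
    using assms inj_q disj by (intro sum.cong) (auto dest: inj_onD)
  then show ?thesis
    using assms by (simp add: cross_chart_def)
qed

lemma cross_chart_outside:
  assumes "v \<notin> p ` {..n} \<union> q ` {..n}"
  shows "cross_chart n p q u v = 0"
proof -
  have "(\<Sum>i\<le>n. (if v = p i then max (u i) 0 else 0) + (if v = q i then max (- u i) 0 else 0)) = 0"
    using assms by (intro sum.neutral) auto
  then show ?thesis
    by (simp add: cross_chart_def)
qed

lemma sum_vertices:
  fixes f :: "'a \<Rightarrow> real"
  shows "(\<Sum>v\<in>p ` {..n} \<union> q ` {..n}. f v) = (\<Sum>i\<le>n. f (p i) + f (q i))"
  using disj inj_p inj_q
  by (simp add: sum.union_disjoint sum.reindex sum.distrib)

lemma cross_chart_in_realization:
  assumes u: "u \<in> topspace (nsphere n)"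
  shows "cross_chart n p q u \<in> topspace (geometric_realization (cross_polytope {..n} p q))"
proof -
  let ?\<phi> = "cross_chart n p q u" and ?N = "\<Sum>i\<le>n. \<bar>u i\<bar>"
  have N: "0 < ?N"
    by (rule sum_abs_pos_nsphere[OF u])
  have supp: "{v. ?\<phi> v \<noteq> 0} \<subseteq> p ` {..n} \<union> q ` {..n}"
    using cross_chart_outside by blast
  have "0 \<le> ?\<phi> v" for v
    unfolding cross_chart_def by (intro divide_nonneg_nonneg sum_nonneg) auto
  moreover have "{v. ?\<phi> v \<noteq> 0} \<in> cross_polytope {..n} p q"
    using supp by (auto simp: cross_polytope_def cross_chart_p cross_chart_q)
  moreover have "(\<Sum>v | ?\<phi> v \<noteq> 0. ?\<phi> v) = 1"
  proof -
    have "(\<Sum>v | ?\<phi> v \<noteq> 0. ?\<phi> v) = (\<Sum>v\<in>p ` {..n} \<union> q ` {..n}. ?\<phi> v)"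
      using supp by (intro sum.mono_neutral_left) auto
    also have "\<dots> = (\<Sum>i\<le>n. \<bar>u i\<bar> / ?N)"
      unfolding sum_vertices
      by (intro sum.cong) (auto simp: cross_chart_p cross_chart_q max_def)
    also have "\<dots> = 1"
      using N by (simp flip: sum_divide_distrib)
    finally show ?thesis .
  qed
  ultimately show ?thesis
    by (simp add: topspace_geometric_realization)
qed

text \<open>The difference of the weights at \<open>p i\<close> and \<open>q i\<close> is
  \<open>u i\<close> divided by the sum of absolute values. Hence the chart determines
  \<open>u\<close> up to a positive factor \<open>c\<close>, and the Euclidean normalization forces
  \<open>c = 1\<close>.\<close>

lemma inj_on_cross_chart: "inj_on (cross_chart n p q) (topspace (nsphere n))"
proof (rule inj_onI)
  fix u u' assume u: "u \<in> topspace (nsphere n)" and u': "u' \<in> topspace (nsphere n)"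
    and eq: "cross_chart n p q u = cross_chart n p q u'"
  let ?N = "\<Sum>i\<le>n. \<bar>u i\<bar>" and ?N' = "\<Sum>i\<le>n. \<bar>u' i\<bar>"
  have N: "0 < ?N" "0 < ?N'"
    using u u' sum_abs_pos_nsphere by blast+
  define c where "c = ?N / ?N'"
  have c: "0 < c"
    using N by (simp add: c_def)
  have scale: "u i = c * u' i" if i: "i \<le> n" for i
  proof -
    have diff: "u i / ?N = max (u i) 0 / ?N - max (- u i) 0 / ?N"
      "u' i / ?N' = max (u' i) 0 / ?N' - max (- u' i) 0 / ?N'"
      by (auto simp: max_def)
    have "u i / ?N = u' i / ?N'"
      unfolding diff
      using fun_cong[OF eq, of "p i"] fun_cong[OF eq, of "q i"] i
      by (simp add: cross_chart_p cross_chart_q)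
    then show ?thesis
      using N by (simp add: c_def field_simps)
  qed
  have "(\<Sum>i\<le>n. (u i)\<^sup>2) = c\<^sup>2 * (\<Sum>i\<le>n. (u' i)\<^sup>2)"
    by (simp add: scale power_mult_distrib sum_distrib_left)
  then have "c\<^sup>2 = 1"
    using u u' by (simp add: topspace_nsphere)
  then have "c = 1"
    using c by (simp add: power2_eq_1_iff)
  then have "u i = u' i" for i
    using scale[of i] u u' by (cases "i \<le> n") (simp_all add: topspace_nsphere)
  then show "u = u'"
    by blast
qed

text \<open>A preimage of \<open>x\<close> is the vector \<open>t\<close> of differences
  \<open>x (p i) - x (q i)\<close>, rescaled to Euclidean length 1. Since one weight of each pair is
  0, these differences recover both weights.\<close>

lemma cross_chart_image:
  "cross_chart n p q ` topspace (nsphere n) =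
     topspace (geometric_realization (cross_polytope {..n} p q))"
proof (intro equalityI subsetI)
  fix x assume x: "x \<in> topspace (geometric_realization (cross_polytope {..n} p q))"
  have nn: "0 \<le> x v" for v
    using x by (simp add: topspace_geometric_realization)
  have supp: "{v. x v \<noteq> 0} \<subseteq> p ` {..n} \<union> q ` {..n}"
    and zero: "\<And>i. i \<le> n \<Longrightarrow> x (p i) = 0 \<or> x (q i) = 0"
    using x by (auto simp: topspace_geometric_realization cross_polytope_def)
  have "(\<Sum>v | x v \<noteq> 0. x v) = (\<Sum>v\<in>p ` {..n} \<union> q ` {..n}. x v)"
    using supp by (intro sum.mono_neutral_left) auto
  then have sum1: "(\<Sum>i\<le>n. x (p i) + x (q i)) = 1"
    using x by (simp add: topspace_geometric_realization sum_vertices)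
  define t where "t i = (if i \<le> n then x (p i) - x (q i) else 0)" for i
  define r where "r = sqrt (\<Sum>i\<le>n. (t i)\<^sup>2)"
  define u where "u i = t i / r" for i
  have abs_t: "\<bar>t i\<bar> = x (p i) + x (q i)" if "i \<le> n" for i
    using that zero[OF that] nn by (auto simp: t_def)
  have "r \<noteq> 0"
  proof
    assume "r = 0"
    then have "\<forall>i\<le>n. t i = 0"
      by (simp add: r_def sum_nonneg_eq_0_iff)
    then have "(\<Sum>i\<le>n. x (p i) + x (q i)) = 0"
      using abs_t by (intro sum.neutral) force
    with sum1 show False
      by simp
  qed
  moreover have "0 \<le> r"
    by (simp add: r_def sum_nonneg)
  ultimately have r: "0 < r"
    by simp
  have "r\<^sup>2 = (\<Sum>i\<le>n. (t i)\<^sup>2)"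
    by (simp add: r_def sum_nonneg)
  then have "(\<Sum>i\<le>n. (u i)\<^sup>2) = 1"
    using r by (simp add: u_def power_divide flip: sum_divide_distrib \<open>r\<^sup>2 = _\<close>)
  then have u: "u \<in> topspace (nsphere n)"
    by (simp add: topspace_nsphere u_def t_def)
  \<comment> \<open>The absolute values of \<open>t\<close> sum to 1, so dividing by
    \<open>r\<close> in the sphere is undone by the normalization in the chart.\<close>
  have N: "(\<Sum>i\<le>n. \<bar>u i\<bar>) = 1 / r"
    using r sum1 by (simp add: u_def abs_t flip: sum_divide_distrib)
  have "cross_chart n p q u v = x v" for v
  proof (cases "v \<in> p ` {..n} \<union> q ` {..n}")
    case True
    then obtain i where i: "i \<le> n" "v = p i \<or> v = q i"
      by auto
    have "max (u i) 0 * r = x (p i)" "max (- u i) 0 * r = x (q i)"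
      using r zero[OF i(1)] nn[of "p i"] nn[of "q i"] i(1)
      by (auto simp: u_def t_def max_def divide_le_0_iff zero_le_divide_iff)
    then show ?thesis
      using i by (auto simp: cross_chart_p cross_chart_q N)
  next
    case False
    then show ?thesis
      using supp cross_chart_outside[OF False] by auto
  qed
  then have "cross_chart n p q u = x"
    by blast
  with u show "x \<in> cross_chart n p q ` topspace (nsphere n)"
    by blast
qed (use cross_chart_in_realization in auto)

lemma cross_chart_basepoint:
  "cross_chart n p q sphere_basepoint v = (if v = p 0 then 1 else 0)"
proof -
  have N: "(\<Sum>i\<le>n. \<bar>sphere_basepoint i\<bar>) = 1"
    by (simp add: sphere_basepoint_def if_distrib[of abs] cong: if_cong)
  consider i where "i \<le> n" "v = p i" | i where "i \<le> n" "v = q i"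
    | "v \<notin> p ` {..n} \<union> q ` {..n}"
    by auto
  then show ?thesis
  proof cases
    case 1
    then have "v = p 0 \<longleftrightarrow> i = 0"
      using inj_p by (auto dest: inj_onD)
    with 1 show ?thesis
      by (simp add: cross_chart_p N) (simp add: sphere_basepoint_def)
  next
    case 2
    then have "v \<noteq> p 0"
      using disj by auto
    with 2 show ?thesis
      by (simp add: cross_chart_q N) (simp add: sphere_basepoint_def)
  next
    case 3
    then show ?thesis
      using cross_chart_outside[OF 3] by auto
  qed
qed

end

section \<open>Two cross-polytope boundaries sharing a vertex\<close>

lemma sphere_basepoint_in_nsphere: "sphere_basepoint \<in> topspace (nsphere n)"
  unfolding sphere_basepoint_def by (rule in_topspace_nsphere)

text \<open>The two charts combine to a continuous surjection \<open>F\<close> from the disjoint sum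
  of the spheres. The complexes share only the vertex \<open>z\<close>, the image of both base
  points, so \<open>F\<close> identifies exactly the points that the wedge quotient \<open>h\<close>
  identifies. The induced bijection goes from a compact space to a Hausdorff space and is a
  homeomorphism.\<close>

lemma wedge_of_two_spheres_homeomorphic:
  fixes p q :: "nat \<Rightarrow> nat \<Rightarrow> 'a"
  assumes inj: "\<And>k. k < 2 \<Longrightarrow> inj_on (p k) {..n}" "\<And>k. k < 2 \<Longrightarrow> inj_on (q k) {..n}"
    and disj: "\<And>k. k < 2 \<Longrightarrow> p k ` {..n} \<inter> q k ` {..n} = {}"
    and base: "p 0 0 = z" "p 1 0 = z"
    and common: "(p 0 ` {..n} \<union> q 0 ` {..n}) \<inter> (p 1 ` {..n} \<union> q 1 ` {..n}) \<subseteq> {z}"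
  shows "geometric_realization (cross_polytope {..n} (p 0) (q 0) \<union> cross_polytope {..n} (p 1) (q 1))
           homeomorphic_space wedge_of_spheres 2 n"
proof -
  define K where "K k = cross_polytope {..n} (p k) (q k)" for k
  let ?W = "geometric_realization (K 0 \<union> K 1)"
  let ?S = "sum_topology (\<lambda>_. nsphere n) {..<2::nat}"
  define \<phi> where "\<phi> k = cross_chart n (p k) (q k)" for k
  define F where "F = (\<lambda>(k, u). \<phi> k u)"
  define B where "B = {(i, sphere_basepoint) |i. i \<in> {..<2::nat}}"
  define h where "h z = (if z \<in> B then B else {z})" for z
  have wedge: "wedge_of_spheres 2 n = quotient_topology ?S h"
    by (simp only: wedge_of_spheres_def wedge_sum_def h_def[abs_def] B_def Let_def)
  have two: "k = 0 \<or> k = 1" if "k < 2" for k :: nat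
    using that by auto
  have \<phi>_image: "\<phi> k ` topspace (nsphere n) = topspace (geometric_realization (K k))"
    if "k < 2" for k
    unfolding \<phi>_def K_def using that inj disj by (intro cross_chart_image) auto
  have \<phi>_inj: "inj_on (\<phi> k) (topspace (nsphere n))" if "k < 2" for k
    unfolding \<phi>_def using that inj disj by (intro inj_on_cross_chart) auto
  have \<phi>_base: "\<phi> k sphere_basepoint = (\<lambda>v. if v = z then 1 else 0)" if "k < 2" for k
  proof
    show "\<phi> k sphere_basepoint v = (if v = z then 1 else 0)" for v
      unfolding \<phi>_def using that inj disj two[OF that] base
      by (subst cross_chart_basepoint) auto
  qed
  have W: "topspace ?W = topspace (geometric_realization (K 0)) \<union> topspace (geometric_realization (K 1))"
    by (auto simp: topspace_geometric_realization)
  have F_image: "F ` topspace ?S = topspace ?W"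
  proof -
    have "topspace ?S = Pair 0 ` topspace (nsphere n) \<union> Pair 1 ` topspace (nsphere n)"
      by (auto dest!: two)
    then show ?thesis
      by (simp add: image_Un image_image F_def \<phi>_image W del: One_nat_def)
  qed
  have F_cont: "continuous_map ?S ?W F"
  proof (rule continuous_map_into_geometric_realization)
    show "continuous_map ?S euclideanreal (\<lambda>x. F x v)" for v
      unfolding continuous_map_def
    proof (intro conjI allI impI)
      fix U :: "real set" assume "openin euclideanreal U"
      then have *: "openin (nsphere n) {u \<in> topspace (nsphere n). \<phi> k u v \<in> U}" for k
        unfolding \<phi>_def by (rule openin_continuous_map_preimage[OF continuous_map_cross_chart])
      have "{x \<in> topspace ?S. F x v \<in> U} =
          (SIGMA k:{..<2}. {u \<in> topspace (nsphere n). \<phi> k u v \<in> U})"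
        by (auto simp: F_def)
      then show "openin ?S {x \<in> topspace ?S. F x v \<in> U}"
        using * by (simp add: openin_disjoint_union)
    qed simp
    show "F \<in> topspace ?S \<rightarrow> topspace ?W"
      by (simp only: F_image[symmetric] image_subset_iff_funcset[symmetric] order_refl)
  qed
  \<comment> \<open>A common point is supported on common vertices, hence on \<open>z\<close> alone,
    so it is the vertex \<open>z\<close> itself. Injectivity of the charts then identifies both
    preimages with the base point.\<close>
  have meet: "u = sphere_basepoint \<and> u' = sphere_basepoint"
    if u: "u \<in> topspace (nsphere n)" "u' \<in> topspace (nsphere n)" and eq: "\<phi> 0 u = \<phi> 1 u'" for u u'
  proof -
    define x where "x = \<phi> 0 u"
    have "\<phi> k u \<in> topspace (geometric_realization (K k))"
      if "k < 2" "u \<in> topspace (nsphere n)" for k u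
      using that \<phi>_image by blast
    from this[of 0 u] this[of 1 u']
    have x: "x \<in> topspace (geometric_realization (K 0))" "x \<in> topspace (geometric_realization (K 1))"
      using u eq by (simp_all add: x_def)
    then have sum: "(\<Sum>v | x v \<noteq> 0. x v) = 1"
      by (simp add: topspace_geometric_realization)
    have "{v. x v \<noteq> 0} \<subseteq> p 0 ` {..n} \<union> q 0 ` {..n}" "{v. x v \<noteq> 0} \<subseteq> p 1 ` {..n} \<union> q 1 ` {..n}"
      using x by (simp_all add: topspace_geometric_realization K_def cross_polytope_def)
    then have "{v. x v \<noteq> 0} \<subseteq> {z}"
      using common by (meson Int_greatest subset_trans)
    moreover have "{v. x v \<noteq> 0} \<noteq> {}"
    proof
      assume empty: "{v. x v \<noteq> 0} = {}"
      show False
        using sum unfolding empty by simp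
    qed
    ultimately have supp: "{v. x v \<noteq> 0} = {z}"
      by blast
    have "x z = 1"
      using sum unfolding supp by simp
    then have "x = (\<lambda>v. if v = z then 1 else 0)"
      using supp by (fastforce simp: fun_eq_iff)
    then have "\<phi> 0 u = \<phi> 0 sphere_basepoint" "\<phi> 1 u' = \<phi> 1 sphere_basepoint"
      using eq \<phi>_base[of 0] \<phi>_base[of 1] by (simp_all add: x_def)
    then show ?thesis
      using inj_onD[OF \<phi>_inj[of 0] _ u(1) sphere_basepoint_in_nsphere]
        inj_onD[OF \<phi>_inj[of 1] _ u(2) sphere_basepoint_in_nsphere] by simp
  qed
  have fibre: "F x = F y \<longleftrightarrow> h x = h y" if xy: "x \<in> topspace ?S" "y \<in> topspace ?S" for x y
  proof -
    obtain k u k' u' where x: "x = (k, u)" and y: "y = (k', u')"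
      by (cases x, cases y)
    have k: "k < 2" "k' < 2" and u: "u \<in> topspace (nsphere n)" "u' \<in> topspace (nsphere n)"
      using xy x y by auto
    have "F x = F y \<longleftrightarrow> x = y \<or> (x \<in> B \<and> y \<in> B)"
    proof
      assume F: "F x = F y"
      show "x = y \<or> (x \<in> B \<and> y \<in> B)"
      proof (cases "k = k'")
        case True
        then show ?thesis
          using F inj_onD[OF \<phi>_inj[OF k(1)] _ u] by (simp add: F_def x y)
      next
        case False
        then consider "k = 0" "k' = 1" | "k = 1" "k' = 0"
          using k two by blast
        then show ?thesis
        proof cases
          case 1
          then show ?thesis
            using meet[OF u] F by (simp add: F_def x y B_def)
        next
          case 2
          then show ?thesis
            using meet[OF u(2,1)] F by (simp add: F_def x y B_def)
        qed
      qed
    qed (auto simp: F_def B_def \<phi>_base)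
    also have "\<dots> \<longleftrightarrow> h x = h y"
      by (cases "x \<in> B"; cases "y \<in> B") (auto simp: h_def)
    finally show ?thesis .
  qed
  have S_compact: "compact_space ?S"
  proof -
    have "compactin ?S (Pair k ` topspace (nsphere n))" if "k < 2" for k
      using that compact_space_nsphere[of n]
        continuous_map_component_injection[of k "{..<2}" "\<lambda>_. nsphere n"]
      by (simp add: image_compactin compact_space_def)
    then have "compactin ?S (\<Union>k\<in>{..<2}. Pair k ` topspace (nsphere n))"
      by (intro compactin_Union) auto
    moreover have "(\<Union>k\<in>{..<2::nat}. Pair k ` topspace (nsphere n)) = topspace ?S"
      by auto
    ultimately show ?thesis
      by (simp add: compact_space_def)
  qed
  have W_Hausdorff: "Hausdorff_space ?W"
    unfolding geometric_realization_def
    by (intro Hausdorff_space_subtopology) (simp add: Hausdorff_space_product_topology)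
  have quot: "quotient_map ?S (quotient_topology ?S h) h"
    by (rule quotient_map_quotient_topology)
  have lift: "F x = F y" if "x \<in> topspace ?S" "y \<in> topspace ?S" "h x = h y" for x y
    using fibre[OF that(1,2)] that(3) by (rule iffD2)
  obtain g where g: "continuous_map (quotient_topology ?S h) ?W g"
    and g_image: "g ` topspace (quotient_topology ?S h) = F ` topspace ?S"
    and gh: "\<And>x. x \<in> topspace ?S \<Longrightarrow> g (h x) = F x"
    using quotient_map_lift_exists[OF quot F_cont lift] by blast
  have "homeomorphic_map (quotient_topology ?S h) ?W g"
  proof (rule continuous_imp_homeomorphic_map[OF g _ W_Hausdorff])
    show "compact_space (quotient_topology ?S h)"
      unfolding compact_space_def topspace_quotient_topology
      using S_compact quotient_imp_continuous_map[OF quot]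
      by (intro image_compactin) (auto simp: compact_space_def)
    show "g ` topspace (quotient_topology ?S h) = topspace ?W"
      using g_image F_image by simp
    show "inj_on g (topspace (quotient_topology ?S h))"
      unfolding topspace_quotient_topology
    proof (rule inj_onI, elim imageE)
      fix a b x y assume "g a = g b" "a = h x" "b = h y" "x \<in> topspace ?S" "y \<in> topspace ?S"
      then show "a = b"
        using fibre[of x y] gh by simp
    qed
  qed
  then have "quotient_topology ?S h homeomorphic_space ?W"
    by (rule homeomorphic_map_imp_homeomorphic_space)
  then show ?thesis
    unfolding wedge K_def by (rule homeomorphic_space_sym[THEN iffD1])
qed


section \<open>Two cones attached to a simplex\<close>

text \<open>A full simplex on \<open>V\<close> with a cone from \<open>x\<close> over
  \<open>L\<close> and a cone from \<open>y\<close> over \<open>M\<close>. The bases of the cones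
  need no separate listing when \<open>L\<close> and \<open>M\<close> consist of subsets of
  \<open>V\<close>.\<close>

definition two_cones :: "'a set \<Rightarrow> 'a \<Rightarrow> 'a \<Rightarrow> 'a set set \<Rightarrow> 'a set set \<Rightarrow> 'a set set" where
  "two_cones V x y L M = Pow V \<union> insert x ` L \<union> insert y ` M"

lemma two_conesI:
  "\<sigma> \<subseteq> V \<Longrightarrow> \<sigma> \<in> two_cones V x y L M"
  "\<tau> \<in> L \<Longrightarrow> insert x \<tau> \<in> two_cones V x y L M"
  "\<tau> \<in> M \<Longrightarrow> insert y \<tau> \<in> two_cones V x y L M"
  by (simp_all add: two_cones_def)

lemma two_conesE:
  assumes "\<sigma> \<in> two_cones V x y L M"
  obtains "\<sigma> \<subseteq> V" | \<tau> where "\<tau> \<in> L" "\<sigma> = insert x \<tau>" | \<tau> where "\<tau> \<in> M" "\<sigma> = insert y \<tau>"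
  using assms unfolding two_cones_def by blast

definition subcomplex :: "'a set \<Rightarrow> 'a set set \<Rightarrow> bool" where
  "subcomplex V L \<longleftrightarrow> simplicial L \<and> L \<subseteq> Pow V"

text \<open>\<open>L\<close> and \<open>L'\<close> are compared only through the cones over them
  attached to the simplex on \<open>V\<close>. Quantifying over the other cone allows the two links
  to be changed independently.\<close>

definition link_equiv :: "'a set \<Rightarrow> 'a set set \<Rightarrow> 'a set set \<Rightarrow> bool" where
  "link_equiv V L L' \<longleftrightarrow> (\<forall>x y M. x \<notin> V \<longrightarrow> y \<notin> V \<longrightarrow> x \<noteq> y \<longrightarrow> subcomplex V M \<longrightarrow>
     geometric_realization (two_cones V x y L M) homotopy_equivalent_space
     geometric_realization (two_cones V x y L' M))"

lemma link_equiv_refl: "link_equiv V L L"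
  by (simp add: link_equiv_def homotopy_equivalent_space_refl)

lemma link_equiv_sym: "link_equiv V L L' \<Longrightarrow> link_equiv V L' L"
  unfolding link_equiv_def using homotopy_equivalent_space_sym by blast

lemma link_equiv_trans [trans]: "link_equiv V L L' \<Longrightarrow> link_equiv V L' L'' \<Longrightarrow> link_equiv V L L''"
  unfolding link_equiv_def using homotopy_eqv_trans by blast

lemma simplicial_two_cones:
  assumes "finite V" "subcomplex V L" "subcomplex V M"
  shows "simplicial (two_cones V x y L M)"
proof -
  have cone: "finite \<sigma> \<and> Pow \<sigma> \<subseteq> Pow V \<union> insert v ` N"
    if \<sigma>: "\<sigma> \<in> insert v ` N" and N: "subcomplex V N" for \<sigma> v N
  proof -
    obtain \<tau> where \<tau>: "\<tau> \<in> N" "\<sigma> = insert v \<tau>"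
      using \<sigma> by blast
    have "\<rho> \<in> Pow V \<union> insert v ` N" if "\<rho> \<subseteq> \<sigma>" for \<rho>
    proof -
      have "\<rho> - {v} \<subseteq> \<tau>"
        using that \<tau> by auto
      then have "\<rho> - {v} \<in> N"
        using \<tau> N by (auto simp: subcomplex_def simplicial_def)
      moreover from this have "\<rho> - {v} \<subseteq> V"
        using N by (auto simp: subcomplex_def)
      ultimately show ?thesis
        using image_eqI[of \<rho> "insert v" "\<rho> - {v}" N] by (cases "v \<in> \<rho>") (simp_all add: insert_absorb)
    qed
    then show ?thesis
      using \<tau> N by (auto simp: subcomplex_def simplicial_def)
  qed
  show ?thesis
    unfolding simplicial_def
  proof
    fix \<sigma> assume "\<sigma> \<in> two_cones V x y L M"
    then consider "\<sigma> \<subseteq> V" | "\<sigma> \<in> insert x ` L" | "\<sigma> \<in> insert y ` M"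
      by (auto simp: two_cones_def)
    then show "finite \<sigma> \<and> Pow \<sigma> \<subseteq> two_cones V x y L M"
    proof cases
      case 1
      then show ?thesis
        using finite_subset[OF 1 assms(1)] by (auto simp: two_cones_def)
    next
      case 2
      then show ?thesis
        using cone[OF 2 assms(2)] unfolding two_cones_def by blast
    next
      case 3
      then show ?thesis
        using cone[OF 3 assms(3)] unfolding two_cones_def by blast
    qed
  qed
qed

text \<open>This is the collapse of the edge \<open>{x, v}\<close> with \<open>w\<close> as the
  extending vertex. Only faces through both \<open>x\<close> and \<open>v\<close> disappear;
  \<open>v\<close> remains in the simplex on \<open>V\<close>.\<close>

lemma link_equiv_delete_vertex:
  assumes V: "finite V" "subcomplex V L" "v \<in> V" "w \<in> V" "w \<noteq> v"
    and cone: "\<And>\<sigma>. \<sigma> \<in> L \<Longrightarrow> v \<in> \<sigma> \<Longrightarrow> insert w \<sigma> \<in> L"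
  shows "link_equiv V L {\<sigma>\<in>L. v \<notin> \<sigma>}"
  unfolding link_equiv_def
proof (intro allI impI)
  fix x y M assume xy: "x \<notin> V" "y \<notin> V" "x \<noteq> y" and M: "subcomplex V M"
  let ?D = "two_cones V x y L M"
  have sub: "\<sigma> \<subseteq> V" if "\<sigma> \<in> L \<or> \<sigma> \<in> M" for \<sigma>
    using that V M by (auto simp: subcomplex_def)
  have "geometric_realization ?D homotopy_equivalent_space
          geometric_realization {\<sigma>\<in>?D. \<not> {x, v} \<subseteq> \<sigma>}"
  proof (rule homotopy_equivalent_collapse)
    show "simplicial ?D"
      using V M by (intro simplicial_two_cones)
    show "w \<notin> {x, v}"
      using V xy by auto
    fix \<sigma> assume \<sigma>: "\<sigma> \<in> ?D" "{x, v} \<subseteq> \<sigma>"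
    have "x \<notin> \<rho>" if "\<rho> \<subseteq> V \<or> (\<exists>\<tau>\<in>M. \<rho> = insert y \<tau>)" for \<rho>
      using that xy sub by blast
    with \<sigma> obtain \<tau> where \<tau>: "\<tau> \<in> L" "\<sigma> = insert x \<tau>"
      by (metis two_conesE insert_subset)
    then have "insert w \<tau> \<in> L"
      using \<sigma> xy V(3) by (intro cone) auto
    moreover have "insert w \<sigma> = insert x (insert w \<tau>)"
      using \<tau> by auto
    ultimately show "insert w \<sigma> \<in> ?D"
      by (simp add: two_cones_def)
  qed auto
  also have "{\<sigma>\<in>?D. \<not> {x, v} \<subseteq> \<sigma>} = two_cones V x y {\<sigma>\<in>L. v \<notin> \<sigma>} M"
  proof (intro equalityI subsetI)
    fix \<sigma> assume "\<sigma> \<in> {\<sigma>\<in>?D. \<not> {x, v} \<subseteq> \<sigma>}"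
    then have \<sigma>: "\<sigma> \<in> ?D" "\<not> {x, v} \<subseteq> \<sigma>"
      by blast+
    from \<sigma>(1) show "\<sigma> \<in> two_cones V x y {\<sigma>\<in>L. v \<notin> \<sigma>} M"
      by (cases rule: two_conesE) (use \<sigma>(2) in \<open>simp_all add: two_conesI\<close>)
  next
    fix \<sigma> assume "\<sigma> \<in> two_cones V x y {\<sigma>\<in>L. v \<notin> \<sigma>} M"
    then show "\<sigma> \<in> {\<sigma>\<in>?D. \<not> {x, v} \<subseteq> \<sigma>}"
    proof (cases rule: two_conesE)
      case 1
      then show ?thesis
        using xy by (auto intro: two_conesI)
    next
      case (2 \<tau>)
      then have "v \<notin> \<sigma>"
        using xy V(3) by auto
      with 2 show ?thesis
        by (simp add: two_conesI)
    next
      case (3 \<tau>)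
      then have "x \<notin> \<sigma>"
        using xy sub[of \<tau>] by auto
      with 3 show ?thesis
        by (simp add: two_conesI)
    qed
  qed
  finally show "geometric_realization ?D homotopy_equivalent_space
      geometric_realization (two_cones V x y {\<sigma>\<in>L. v \<notin> \<sigma>} M)" .
qed

text \<open>The links are replaced one at a time, exchanging the roles of the two cones for the
  second replacement.\<close>

lemma two_cones_homotopy_equivalent:
  assumes "x \<notin> V" "y \<notin> V" "x \<noteq> y" "subcomplex V L'" "subcomplex V M"
    and "link_equiv V L L'" "link_equiv V M M'"
  shows "geometric_realization (two_cones V x y L M) homotopy_equivalent_space
           geometric_realization (two_cones V x y L' M')"
proof -
  have commute: "two_cones V x y L' N = two_cones V y x N L'" for N
    by (auto simp: two_cones_def)
  have "geometric_realization (two_cones V x y L M) homotopy_equivalent_space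
          geometric_realization (two_cones V x y L' M)"
    using assms by (simp add: link_equiv_def)
  also have "geometric_realization (two_cones V x y L' M) homotopy_equivalent_space
          geometric_realization (two_cones V x y L' M')"
    unfolding commute using assms by (simp add: link_equiv_def)
  finally show ?thesis .
qed

section \<open>Vertex replacement and suspension of cross-polytope boundaries\<close>

lemma simplicial_cross_polytope:
  assumes "finite I"
  shows "simplicial (cross_polytope I p q)"
  unfolding simplicial_def
proof (intro ballI conjI subsetI)
  fix \<sigma> assume \<sigma>: "\<sigma> \<in> cross_polytope I p q"
  then show "finite \<sigma>"
    using assms by (auto simp: cross_polytope_def intro: finite_subset)
  show "\<tau> \<in> cross_polytope I p q" if "\<tau> \<in> Pow \<sigma>" for \<tau>
    using that \<sigma> unfolding cross_polytope_def by blast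
qed

text \<open>In the auxiliary complex \<open>L\<close> the vertices \<open>s\<close> and
  \<open>q j\<close> are twins: both are opposite to \<open>p j\<close>, and a face containing one
  can be extended by the other. Deleting \<open>s\<close> gives the old cross-polytope boundary and
  deleting \<open>q j\<close> the new one.\<close>

lemma link_equiv_replace_vertex:
  assumes V: "finite V" "finite I" "p ` I \<union> q ` I \<subseteq> V" "s \<in> V"
    and s: "s \<notin> p ` I \<union> q ` I" and j: "j \<in> I" "q j \<notin> p ` I" and inj: "inj_on q I"
  shows "link_equiv V (cross_polytope I p q) (cross_polytope I p (q(j := s)))"
proof -
  define L where "L = {\<sigma>. \<sigma> \<subseteq> insert s (p ` I \<union> q ` I) \<and>
    (\<forall>i\<in>I. p i \<notin> \<sigma> \<or> q i \<notin> \<sigma>) \<and> (p j \<notin> \<sigma> \<or> s \<notin> \<sigma>)}"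
  have qj: "q i = q j \<longleftrightarrow> i = j" if "i \<in> I" for i
    using that inj j by (auto dest: inj_onD)
  have sub: "subcomplex V L"
    unfolding subcomplex_def simplicial_def
  proof (intro conjI ballI subsetI)
    fix \<sigma> assume \<sigma>: "\<sigma> \<in> L"
    then have "\<sigma> \<subseteq> V"
      using V(3,4) unfolding L_def by blast
    then show "\<sigma> \<in> Pow V" "finite \<sigma>"
      using V(1) finite_subset by auto
    show "\<tau> \<in> L" if "\<tau> \<in> Pow \<sigma>" for \<tau>
      using that \<sigma> unfolding L_def by blast
  qed
  have "link_equiv V L {\<sigma>\<in>L. s \<notin> \<sigma>}"
  proof (rule link_equiv_delete_vertex[OF V(1) sub])
    show "insert (q j) \<sigma> \<in> L" if "\<sigma> \<in> L" "s \<in> \<sigma>" for \<sigma>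
    proof -
      have \<sigma>: "\<sigma> \<subseteq> insert s (p ` I \<union> q ` I)" "p j \<notin> \<sigma>"
        and free: "\<And>i. i \<in> I \<Longrightarrow> p i \<notin> \<sigma> \<or> q i \<notin> \<sigma>"
        using that by (simp_all add: L_def)
      have pj: "p i \<noteq> q j" if "i \<in> I" for i
        using that j(2) by force
      have "p i \<notin> insert (q j) \<sigma> \<or> q i \<notin> insert (q j) \<sigma>" if "i \<in> I" for i
        using free[OF that] pj[OF that] qj[OF that] \<sigma>(2) by (cases "i = j") simp_all
      then show ?thesis
        using \<sigma> pj[OF j(1)] j(1) unfolding L_def by blast
    qed
  qed (use V s j in blast)+
  also have "{\<sigma>\<in>L. s \<notin> \<sigma>} = cross_polytope I p q"
    using s by (auto simp: L_def cross_polytope_def)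
  finally have 1: "link_equiv V L (cross_polytope I p q)" .
  have "link_equiv V L {\<sigma>\<in>L. q j \<notin> \<sigma>}"
  proof (rule link_equiv_delete_vertex[OF V(1) sub])
    show "insert s \<sigma> \<in> L" if "\<sigma> \<in> L" "q j \<in> \<sigma>" for \<sigma>
    proof -
      have \<sigma>: "\<sigma> \<subseteq> insert s (p ` I \<union> q ` I)" "p j \<notin> \<sigma>"
        and free: "\<And>i. i \<in> I \<Longrightarrow> p i \<notin> \<sigma> \<or> q i \<notin> \<sigma>"
        using that j(1) by (auto simp: L_def)
      have ps: "p i \<noteq> s" "q i \<noteq> s" if "i \<in> I" for i
        using that s by force+
      have "p i \<notin> insert s \<sigma> \<or> q i \<notin> insert s \<sigma>" if "i \<in> I" for i
        using free[OF that] ps[OF that] by simp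
      then show ?thesis
        using \<sigma> ps[OF j(1)] unfolding L_def by blast
    qed
  qed (use V s j in blast)+
  also have "{\<sigma>\<in>L. q j \<notin> \<sigma>} = cross_polytope I p (q(j := s))"
  proof -
    have img: "p ` I \<union> (q(j := s)) ` I = insert s (p ` I \<union> q ` I) - {q j}"
    proof -
      have 1: "(q(j := s)) ` I = insert s (q ` (I - {j}))"
        using j(1) by auto
      have 2: "q ` (I - {j}) = q ` I - {q j}"
        using inj j(1) by (auto simp: inj_on_def)
      have "s \<noteq> q j"
        using s j(1) by blast
      then show ?thesis
        unfolding 1 2 using j(2) by blast
    qed
    have free: "(\<forall>i\<in>I. p i \<notin> \<sigma> \<or> (q(j := s)) i \<notin> \<sigma>) \<longleftrightarrow>
        (\<forall>i\<in>I. p i \<notin> \<sigma> \<or> q i \<notin> \<sigma>) \<and> (p j \<notin> \<sigma> \<or> s \<notin> \<sigma>)" if "q j \<notin> \<sigma>" for \<sigma>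
      using that j(1) by (auto split: if_splits)
    have "\<sigma> \<in> {\<sigma>\<in>L. q j \<notin> \<sigma>} \<longleftrightarrow> \<sigma> \<in> cross_polytope I p (q(j := s))" for \<sigma>
    proof (cases "q j \<in> \<sigma>")
      case True
      then show ?thesis
        unfolding cross_polytope_def img by blast
    next
      case False
      then show ?thesis
        unfolding cross_polytope_def L_def img mem_Collect_eq free[OF False] by blast
    qed
    then show ?thesis
      by blast
  qed
  finally show ?thesis
    by (rule link_equiv_trans[OF link_equiv_sym[OF 1]])
qed

text \<open>Adding an antipodal pair is joining with two points, here \<open>z\<close> and
  \<open>x\<close>. The pair gets the free index 0 with \<open>z\<close> on the positive side, so
  that \<open>z\<close> corresponds to the base point of the sphere.\<close>

lemma cross_polytope_suspension:
  fixes p q :: "nat \<Rightarrow> 'a"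
  assumes "x \<noteq> z" "{x, z} \<inter> (p ` {1..n} \<union> q ` {1..n}) = {}"
  shows "cross_polytope {..n} (p(0 := z)) (q(0 := x)) =
     (let C = cross_polytope {1..n} p q in C \<union> insert z ` C \<union> insert x ` C)"
proof -
  let ?C = "cross_polytope {1..n} p q"
  have n: "{..n} = insert 0 {1..n}"
    by auto
  have mem: "\<sigma> \<in> cross_polytope {..n} (p(0 := z)) (q(0 := x)) \<longleftrightarrow>
      \<sigma> - {x, z} \<in> ?C \<and> (x \<notin> \<sigma> \<or> z \<notin> \<sigma>)" for \<sigma>
  proof -
    have img: "(p(0 := z)) ` {..n} \<union> (q(0 := x)) ` {..n} = {x, z} \<union> (p ` {1..n} \<union> q ` {1..n})"
      unfolding n by auto
    have "(\<forall>i\<in>{..n}. (p(0 := z)) i \<notin> \<sigma> \<or> (q(0 := x)) i \<notin> \<sigma>) \<longleftrightarrow>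
        (z \<notin> \<sigma> \<or> x \<notin> \<sigma>) \<and> (\<forall>i\<in>{1..n}. p i \<notin> \<sigma> \<or> q i \<notin> \<sigma>)"
      unfolding n by auto
    moreover have "(\<forall>i\<in>{1..n}. p i \<notin> \<sigma> \<or> q i \<notin> \<sigma>) \<longleftrightarrow>
        (\<forall>i\<in>{1..n}. p i \<notin> \<sigma> - {x, z} \<or> q i \<notin> \<sigma> - {x, z})"
      using assms(2) by (intro ball_cong refl) blast
    ultimately show ?thesis
      unfolding cross_polytope_def mem_Collect_eq img by blast
  qed
  have C: "x \<notin> \<tau>" "z \<notin> \<tau>" if "\<tau> \<in> ?C" for \<tau>
    using that assms by (auto simp: cross_polytope_def)
  show ?thesis
    unfolding Let_def
  proof (intro set_eqI iffI)
    fix \<sigma> assume "\<sigma> \<in> cross_polytope {..n} (p(0 := z)) (q(0 := x))"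
    then have \<sigma>: "\<sigma> - {x, z} \<in> ?C" "x \<notin> \<sigma> \<or> z \<notin> \<sigma>"
      by (auto simp: mem)
    then consider "\<sigma> = \<sigma> - {x, z}" | "\<sigma> = insert z (\<sigma> - {x, z})" | "\<sigma> = insert x (\<sigma> - {x, z})"
      by blast
    then show "\<sigma> \<in> ?C \<union> insert z ` ?C \<union> insert x ` ?C"
      using \<sigma>(1) by cases auto
  next
    fix \<sigma> assume "\<sigma> \<in> ?C \<union> insert z ` ?C \<union> insert x ` ?C"
    then obtain \<tau> where \<tau>: "\<tau> \<in> ?C" "\<sigma> = \<tau> \<or> \<sigma> = insert z \<tau> \<or> \<sigma> = insert x \<tau>"
      by blast
    then have "\<sigma> - {x, z} = \<tau>"
      using C[OF \<tau>(1)] by auto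
    then show "\<sigma> \<in> cross_polytope {..n} (p(0 := z)) (q(0 := x))"
      using \<tau> C[OF \<tau>(1)] assms(1) by (auto simp: mem)
  qed
qed

text \<open>\<open>W\<close> is the union of the suspension of the first complex with apices
  \<open>z\<close>, \<open>x\<close> and that of the second with apices \<open>z\<close>,
  \<open>y\<close>; these share only \<open>z\<close>. The faces of \<open>W\<close> inside
  \<open>V\<close> form a cone with apex \<open>z\<close>, and thickening it to the simplex on
  \<open>V\<close> produces the two cones.\<close>

lemma two_cones_cross_polytopes:
  fixes p q p' q' :: "nat \<Rightarrow> 'a"
  assumes V: "finite V" "x \<notin> V" "y \<notin> V" "x \<noteq> y" "z \<in> V"
    and pq: "p ` {1..n} \<union> q ` {1..n} \<subseteq> V - {z}" "p' ` {1..n} \<union> q' ` {1..n} \<subseteq> V - {z}"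
    and inj: "inj_on p {1..n}" "inj_on q {1..n}" "inj_on p' {1..n}" "inj_on q' {1..n}"
    and disj: "p ` {1..n} \<inter> q ` {1..n} = {}" "p' ` {1..n} \<inter> q' ` {1..n} = {}"
      "(p ` {1..n} \<union> q ` {1..n}) \<inter> (p' ` {1..n} \<union> q' ` {1..n}) = {}"
  shows "geometric_realization
           (two_cones V x y (cross_polytope {1..n} p q) (cross_polytope {1..n} p' q'))
           homotopy_equivalent_space wedge_of_spheres 2 n"
proof -
  define C where "C = cross_polytope {1..n} p q"
  define C' where "C' = cross_polytope {1..n} p' q'"
  define W where "W = cross_polytope {..n} (p(0 := z)) (q(0 := x)) \<union>
    cross_polytope {..n} (p'(0 := z)) (q'(0 := y))"
  have W: "W = (C \<union> insert z ` C \<union> insert x ` C) \<union> (C' \<union> insert z ` C' \<union> insert y ` C')"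
    unfolding W_def C_def C'_def Let_def
    using V pq by (subst (1 2) cross_polytope_suspension) (auto simp: Let_def)
  have CV: "\<sigma> \<subseteq> V" if "\<sigma> \<in> C \<union> C'" for \<sigma>
    using that pq unfolding C_def C'_def cross_polytope_def by blast
  have "geometric_realization W homotopy_equivalent_space geometric_realization (W \<union> Pow V)"
  proof (rule homotopy_equivalent_Un_Pow)
    show "simplicial W"
      using simplicial_cross_polytope[of "{..n}" "p(0 := z)" "q(0 := x)"]
        simplicial_cross_polytope[of "{..n}" "p'(0 := z)" "q'(0 := y)"]
      by (auto simp: simplicial_def W_def)
    show "{} \<in> W"
      by (simp add: W_def cross_polytope_def)
    show "insert z \<sigma> \<in> W" if "\<sigma> \<in> W" "\<sigma> \<subseteq> V" for \<sigma>
    proof -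
      have "\<sigma> \<in> (C \<union> C') \<union> insert z ` (C \<union> C')"
        using that V by (auto simp: W)
      then have "insert z \<sigma> \<in> insert z ` (C \<union> C')"
        by auto
      then show ?thesis
        by (auto simp: W)
    qed
  qed (use V in auto)
  \<comment> \<open>\<open>C\<close>, \<open>C'\<close> and their cones from \<open>z\<close> are
    absorbed by the simplex on \<open>V\<close>; only the cones from \<open>x\<close> and
    \<open>y\<close> stick out.\<close>
  also have "W \<union> Pow V = two_cones V x y C C'"
    using CV V(5) by (auto simp: W two_cones_def)
  finally have "geometric_realization (two_cones V x y C C') homotopy_equivalent_space
      geometric_realization W"
    by (rule homotopy_equivalent_space_sym[THEN iffD1])
  also have "geometric_realization W homeomorphic_space wedge_of_spheres 2 n"
  proof -
    define P where "P k = (if k = (0::nat) then p(0 := z) else p'(0 := z))" for k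
    define Q where "Q k = (if k = (0::nat) then q(0 := x) else q'(0 := y))" for k
    have n: "{..n} = insert 0 {1..n}"
      by auto
    have im: "f(0 := a) ` {..n} = insert a (f ` {1..n})" for f :: "nat \<Rightarrow> 'a" and a
      unfolding n by auto
    have inj0: "inj_on (f(0 := a)) {..n}"
      if "inj_on f {1..n}" "a \<notin> f ` {1..n}" for f :: "nat \<Rightarrow> 'a" and a
    proof -
      have "(f(0 := a)) ` ({1..n} - {0}) = f ` {1..n}"
        by (intro image_cong) auto
      then show ?thesis
        unfolding n inj_on_insert using inj_on_fun_updI[OF that] that(2) by simp
    qed
    have "geometric_realization (cross_polytope {..n} (P 0) (Q 0) \<union> cross_polytope {..n} (P 1) (Q 1))
           homeomorphic_space wedge_of_spheres 2 n"
    proof (rule wedge_of_two_spheres_homeomorphic)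
      have "z \<notin> p ` {1..n}" "z \<notin> p' ` {1..n}"
        using pq by blast+
      then show "inj_on (P k) {..n}" for k
        using inj0[OF inj(1)] inj0[OF inj(3)] by (simp add: P_def)
      have "x \<notin> q ` {1..n}" "y \<notin> q' ` {1..n}"
        using pq V(2,3) by blast+
      then show "inj_on (Q k) {..n}" for k
        using inj0[OF inj(2)] inj0[OF inj(4)] by (simp add: Q_def)
      show "P k ` {..n} \<inter> Q k ` {..n} = {}" for k
      proof (cases "k = 0")
        case True
        then show ?thesis
          unfolding P_def Q_def if_P[OF True] im using disj(1) pq V by blast
      next
        case False
        then show ?thesis
          unfolding P_def Q_def if_not_P[OF False] im using disj(2) pq V by blast
      qed
      have 0: "P 0 ` {..n} \<union> Q 0 ` {..n} = {z, x} \<union> (p ` {1..n} \<union> q ` {1..n})"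
      proof -
        have PQ: "P 0 = p(0 := z)" "Q 0 = q(0 := x)"
          by (simp_all add: P_def Q_def)
        show ?thesis
          unfolding PQ im by blast
      qed
      have 1: "P 1 ` {..n} \<union> Q 1 ` {..n} = {z, y} \<union> (p' ` {1..n} \<union> q' ` {1..n})"
      proof -
        have PQ: "P 1 = p'(0 := z)" "Q 1 = q'(0 := y)"
          by (simp_all add: P_def Q_def)
        show ?thesis
          unfolding PQ im by blast
      qed
      show "(P 0 ` {..n} \<union> Q 0 ` {..n}) \<inter> (P 1 ` {..n} \<union> Q 1 ` {..n}) \<subseteq> {z}"
        unfolding 0 1 using disj(3) pq V by blast
    qed (simp_all add: P_def)
    then show ?thesis
      by (simp add: W_def P_def Q_def)
  qed
  then have "geometric_realization W homotopy_equivalent_space wedge_of_spheres 2 n"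
    by (rule homeomorphic_imp_homotopy_equivalent_space)
  finally show ?thesis
    by (simp only: C_def C'_def)
qed


section \<open>The row of hexagons\<close>

text \<open>Without bounds on rows or columns, so that one relation serves for all the induced
  subgraphs that occur during the folding.\<close>

definition adj :: "nat \<times> nat \<Rightarrow> nat \<times> nat \<Rightarrow> bool" where
  "adj u v \<longleftrightarrow> fst u = fst v \<and> (snd v = Suc (snd u) \<or> snd u = Suc (snd v)) \<or>
     fst u \<noteq> fst v \<and> snd u = snd v \<and> odd (snd u)"

definition indep :: "(nat \<times> nat) set \<Rightarrow> (nat \<times> nat) set set" where
  "indep U = {\<sigma>. \<sigma> \<subseteq> U \<and> (\<forall>u\<in>\<sigma>. \<forall>v\<in>\<sigma>. \<not> adj u v)}"

lemma adj_simp: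
  "adj (j, r) (j', r') \<longleftrightarrow> j = j' \<and> (r' = Suc r \<or> r = Suc r') \<or> j \<noteq> j' \<and> r = r' \<and> odd r"
  by (simp add: adj_def)

lemma adj_commute: "adj u v \<longleftrightarrow> adj v u"
  by (auto simp: adj_def)

lemma adj_irrefl: "\<not> adj u u"
  by (simp add: adj_def)

lemma hex_line_edge_iff:
  assumes "u \<in> hex_line_verts n" "v \<in> hex_line_verts n"
  shows "{u, v} \<in> hex_line_edges n \<longleftrightarrow> adj u v"
proof
  assume "{u, v} \<in> hex_line_edges n"
  then consider j r where "{u, v} = {(j, r), (j, r + 1)}"
    | t where "1 \<le> t" "{u, v} = {(1, 2 * t - 1), (2, 2 * t - 1)}"
    by (auto simp: hex_line_edges_def)
  then show "adj u v"
  proof cases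
    case 1
    then show ?thesis
      by (auto simp: doubleton_eq_iff adj_simp)
  next
    case 2
    then show ?thesis
      by (auto simp: doubleton_eq_iff adj_simp)
  qed
next
  assume adj: "adj u v"
  obtain j r j' r' where uv: "u = (j, r)" "v = (j', r')"
    by (cases u, cases v)
  have jr: "j \<in> {1, 2}" "1 \<le> r" "r \<le> 2 * n + 1" "j' \<in> {1, 2}" "1 \<le> r'" "r' \<le> 2 * n + 1"
    using assms by (auto simp: uv hex_line_verts_def)
  have horizontal: "{(i, k), (i, k + 1)} \<in> hex_line_edges n" if "i \<in> {1, 2}" "1 \<le> k" "k \<le> 2 * n" for i k
    unfolding hex_line_edges_def using that by blast
  from adj consider "j' = j" "r' = r + 1" | "j = j'" "r = r' + 1" | "j \<noteq> j'" "r = r'" "odd r"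
    by (auto simp: uv adj_simp)
  then show "{u, v} \<in> hex_line_edges n"
  proof cases
    case 1
    then show ?thesis
      using horizontal[of j r] jr by (simp add: uv)
  next
    case 2
    then show ?thesis
      using horizontal[of j' r'] jr by (simp add: uv insert_commute)
  next
    case 3
    obtain k where k: "r = 2 * k + 1"
      using 3(3) by (elim oddE)
    \<comment> \<open>The rung in column \<open>2 * k + 1\<close> is the one with parameter
      \<open>t = k + 1\<close>.\<close>
    have "{(1, 2 * (k + 1) - 1), (2, 2 * (k + 1) - 1)} \<in> hex_line_edges n"
      unfolding hex_line_edges_def using jr(3) k by (intro UnI2 CollectI exI[of _ "k + 1"]) simp
    moreover have "{u, v} = {(1, r), (2, r)}"
      using jr 3(1,2) by (auto simp: uv)
    ultimately show ?thesis
      by (simp add: k)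
  qed
qed

lemma independence_complex_hex_line:
  "independence_complex (hex_line_verts n) (hex_line_edges n) = indep (hex_line_verts n)"
proof -
  have "(\<forall>u\<in>S. \<forall>v\<in>S. {u, v} \<notin> hex_line_edges n) \<longleftrightarrow> (\<forall>u\<in>S. \<forall>v\<in>S. \<not> adj u v)"
    if "S \<subseteq> hex_line_verts n" for S
    using that by (intro ball_cong refl) (auto simp: hex_line_edge_iff subset_iff)
  then show ?thesis
    unfolding independence_complex_def indep_def by blast
qed

section \<open>Folding along the ladder\<close>

lemma indep_insert:
  assumes "\<sigma> \<in> indep U" "w \<in> U" "\<And>u. u \<in> \<sigma> \<Longrightarrow> \<not> adj w u"
  shows "insert w \<sigma> \<in> indep U"
  using assms adj_irrefl[of w] adj_commute[of _ w] unfolding indep_def by blast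

lemma subcomplex_indep:
  assumes "finite V" "U \<subseteq> V"
  shows "subcomplex V (indep U)"
  unfolding subcomplex_def simplicial_def
proof (intro conjI ballI subsetI)
  fix \<sigma> assume \<sigma>: "\<sigma> \<in> indep U"
  then show "\<sigma> \<in> Pow V" "finite \<sigma>"
    using assms finite_subset[of \<sigma> V] by (auto simp: indep_def)
  show "\<tau> \<in> indep U" if "\<tau> \<in> Pow \<sigma>" for \<tau>
    using that \<sigma> unfolding indep_def by blast
qed

text \<open>Every independent set containing \<open>v\<close> can be extended by \<open>w\<close>,
  because neighbours of \<open>w\<close> are neighbours of \<open>v\<close>. So the dominated vertex
  \<open>v\<close> can be deleted from the link.\<close>

lemma link_equiv_indep_fold:
  assumes V: "finite V" "U \<subseteq> V" and w: "w \<in> U" "w \<noteq> v"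
    and dom: "\<And>u. u \<in> U \<Longrightarrow> adj w u \<Longrightarrow> adj v u"
  shows "link_equiv V (indep U) (indep (U - {v}))"
proof (cases "v \<in> U")
  case True
  have "link_equiv V (indep U) {\<sigma>\<in>indep U. v \<notin> \<sigma>}"
  proof (rule link_equiv_delete_vertex)
    fix \<sigma> assume \<sigma>: "\<sigma> \<in> indep U" "v \<in> \<sigma>"
    then have "\<not> adj w u" if "u \<in> \<sigma>" for u
      using that dom unfolding indep_def by blast
    then show "insert w \<sigma> \<in> indep U"
      by (rule indep_insert[OF \<sigma>(1) w(1)])
  qed (use V w True subcomplex_indep in auto)
  also have "{\<sigma>\<in>indep U. v \<notin> \<sigma>} = indep (U - {v})"
    unfolding indep_def by blast
  finally show ?thesis .
qed (simp add: link_equiv_refl)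

text \<open>The row in which the zigzag runs through columns \<open>2 * i\<close> and
  \<open>2 * i + 1\<close>. The parity of \<open>c\<close> selects one of the two zigzags:
  \<open>c = 0\<close> for the link of \<open>(1, 1)\<close> and \<open>c = 1\<close> for that of
  \<open>(1, 3)\<close>.\<close>

definition side :: "nat \<Rightarrow> nat \<Rightarrow> nat" where
  "side c i = (if even (i + c) then 1 else 2)"

text \<open>
  The stage of the folding at which, in the columns \<open>4, ..., 2 m\<close>, only the vertices on the zigzag
  given by \<open>side c\<close> are left; \<open>P\<close> is the part of the link in the first three columns.
\<close>

definition half_folded :: "nat \<Rightarrow> nat \<Rightarrow> (nat \<times> nat) set \<Rightarrow> nat \<Rightarrow> (nat \<times> nat) set" where
  "half_folded n c P m = P \<union>
     {(j, r). j \<in> {1, 2} \<and> 4 \<le> r \<and> r \<le> 2 * n + 1 \<and> (r \<le> 2 * m \<longrightarrow> j = side c (r div 2))}"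

lemma mem_half_folded_iff:
  "(j, r) \<in> half_folded n c P m \<longleftrightarrow> (j, r) \<in> P \<or>
     j \<in> {1, 2} \<and> 4 \<le> r \<and> r \<le> 2 * n + 1 \<and> (r \<le> 2 * m \<longrightarrow> j = side c (r div 2))"
  by (simp add: half_folded_def)

lemma side_cases: "side c i = 1 \<and> side c (Suc i) = 2 \<or> side c i = 2 \<and> side c (Suc i) = 1"
  by (simp add: side_def)

text \<open>Outside \<open>P\<close>, the only possible neighbour left for \<open>?w\<close> is the
  next vertex in its row, in column \<open>2 * m + 1\<close>. Both \<open>?v\<close>, across the
  rung, and \<open>?v'\<close>, one step further in the row, are adjacent to that vertex, so both
  can be deleted. For \<open>m = n\<close>, \<open>?v'\<close> lies beyond the last column and its
  deletion changes nothing.\<close>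

lemma link_equiv_half_folded_Suc:
  assumes V: "finite V" "half_folded n c P m \<subseteq> V" and m: "1 \<le> m" "m \<le> n"
    and w: "(side c m, 2 * m) \<in> half_folded n c P m"
    and P: "P \<subseteq> UNIV \<times> {..3}" "(3 - side c m, Suc (2 * m)) \<notin> P"
    and dom: "\<And>u. u \<in> P \<Longrightarrow> adj (side c m, 2 * m) u \<Longrightarrow>
      adj (3 - side c m, Suc (2 * m)) u \<and> adj (side c m, 2 * m + 2) u"
  shows "link_equiv V (indep (half_folded n c P m)) (indep (half_folded n c P (Suc m)))"
proof -
  let ?U = "half_folded n c P m"
  let ?w = "(side c m, 2 * m)" and ?v = "(3 - side c m, Suc (2 * m))" and ?v' = "(side c m, 2 * m + 2)"
  have dom': "adj ?v u \<and> adj ?v' u" if u: "u \<in> ?U" "adj ?w u" for u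
  proof (cases "u \<in> P")
    case False
    obtain j r where jr: "u = (j, r)"
      by (cases u)
    have j: "j = side c m" and r: "r = Suc (2 * m) \<or> 2 * m = Suc r"
      using u(2) by (auto simp: jr adj_simp)
    have main: "4 \<le> r" "r \<le> 2 * m \<Longrightarrow> j = side c (r div 2)"
      using u(1) False by (auto simp: jr mem_half_folded_iff)
    \<comment> \<open>The left neighbour, in column \<open>2 * m - 1\<close>, has already been
      deleted: the zigzag uses the other row there.\<close>
    have "r = Suc (2 * m)"
    proof (rule ccontr)
      assume "r \<noteq> Suc (2 * m)"
      with r have r: "2 * m = Suc r"
        by simp
      then obtain k where k: "m = Suc k" "r div 2 = k"
        using m(1) by (cases m) auto
      then show False
        using main(2) r j side_cases[of c k] by auto
    qed
    then show ?thesis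
      using j side_cases[of c m] by (auto simp: jr adj_simp)
  qed (use dom u in blast)
  have "link_equiv V (indep ?U) (indep (?U - {?v}))"
    using V w dom' by (intro link_equiv_indep_fold[where w = ?w]) auto
  also have "link_equiv V (indep (?U - {?v})) (indep (?U - {?v} - {?v'}))"
    using V w dom' by (intro link_equiv_indep_fold[where w = ?w]) auto
  also have "?U - {?v} - {?v'} = half_folded n c P (Suc m)"
  proof -
    have "(j, r) \<in> ?U - {?v} - {?v'} \<longleftrightarrow> (j, r) \<in> half_folded n c P (Suc m)" for j r
    proof (cases "(j, r) \<in> P")
      case True
      then have "r \<le> 3"
        using P(1) by auto
      then have "(j, r) \<noteq> ?v" "(j, r) \<noteq> ?v'"
        using True P(2) m(1) by auto
      with True show ?thesis
        by (simp add: mem_half_folded_iff)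
    next
      case False
      consider "r \<le> 2 * m" | "r = Suc (2 * m)" | "r = 2 * m + 2" | "r > 2 * m + 2"
        by linarith
      then show ?thesis
      proof cases
        case 1
        with False show ?thesis
          by (simp add: mem_half_folded_iff)
      next
        case 2
        then have "r div 2 = m"
          by simp
        with 2 False side_cases[of c m] show ?thesis
          by (auto simp: mem_half_folded_iff)
      next
        case 3
        then have "r div 2 = Suc m"
          by simp
        with 3 False side_cases[of c m] show ?thesis
          by (auto simp: mem_half_folded_iff)
      next
        case 4
        with False show ?thesis
          by (simp add: mem_half_folded_iff)
      qed
    qed
    then show ?thesis
      by auto
  qed
  finally show ?thesis .
qed


text \<open>Iterates the folding step from stage \<open>m0\<close> to the right end of the ladder.
  For \<open>m0 = 1\<close> the vertex folded onto lies in column 2, which the zigzag does not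
  cover, so it has to be supplied by \<open>P\<close>.\<close>

lemma link_equiv_half_folded:
  assumes V: "finite V" "P \<subseteq> V" "{1, 2} \<times> {4..2 * n + 1} \<subseteq> V" and m0: "1 \<le> m0" "m0 \<le> Suc n"
    and w: "m0 = 1 \<Longrightarrow> (side c 1, 2) \<in> P"
    and P: "P \<subseteq> UNIV \<times> {..3}"
      "\<And>m. m0 \<le> m \<Longrightarrow> (3 - side c m, Suc (2 * m)) \<notin> P"
    and dom: "\<And>u m. m0 \<le> m \<Longrightarrow> u \<in> P \<Longrightarrow> adj (side c m, 2 * m) u \<Longrightarrow>
      adj (3 - side c m, Suc (2 * m)) u \<and> adj (side c m, 2 * m + 2) u"
  shows "link_equiv V (indep (half_folded n c P m0)) (indep (half_folded n c P (Suc n)))"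
proof -
  have "k \<le> Suc n \<longrightarrow> link_equiv V (indep (half_folded n c P m0)) (indep (half_folded n c P k))"
    if "m0 \<le> k" for k
    using that
  proof (induction rule: dec_induct)
    case base
    show ?case
      by (simp add: link_equiv_refl)
  next
    case (step m)
    show ?case
    proof
      assume mn: "Suc m \<le> Suc n"
      have "half_folded n c P m \<subseteq> V"
        using V(2,3) by (auto simp: half_folded_def)
      moreover have "(side c m, 2 * m) \<in> half_folded n c P m"
      proof (cases "m = 1")
        case True
        then show ?thesis
          using w m0 step by (simp add: half_folded_def)
      next
        case False
        then have "2 \<le> m"
          using m0 step by linarith
        then show ?thesis
          using mn side_cases[of c m] by (auto simp: mem_half_folded_iff)
      qed
      ultimately have "link_equiv V (indep (half_folded n c P m)) (indep (half_folded n c P (Suc m)))"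
        using V(1) mn m0 step P dom by (intro link_equiv_half_folded_Suc) auto
      moreover have "link_equiv V (indep (half_folded n c P m0)) (indep (half_folded n c P m))"
        using step mn by simp
      ultimately show "link_equiv V (indep (half_folded n c P m0)) (indep (half_folded n c P (Suc m)))"
        using link_equiv_trans by blast
    qed
  qed
  then show ?thesis
    using m0 by blast
qed

section \<open>Zigzags as cross-polytope boundaries\<close>

text \<open>Enumerates one side of the antipodal pairs: \<open>k = 0\<close> takes the even and
  \<open>k = 1\<close> the odd column of each pair. The pair with index 1 lies in the first three
  columns and depends on the link, hence the parameter \<open>a\<close>.\<close>

definition vtx :: "nat \<Rightarrow> nat \<Rightarrow> nat \<times> nat \<Rightarrow> nat \<Rightarrow> nat \<times> nat" where
  "vtx k c a i = (if i = 1 then a else (side c i, 2 * i + k))"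

definition zigzag :: "nat \<Rightarrow> nat \<Rightarrow> (nat \<times> nat) set" where
  "zigzag n c = {(j, r). 4 \<le> r \<and> r \<le> 2 * n + 1 \<and> j = side c (r div 2)}"

text \<open>At stage \<open>Suc n\<close> the bound \<open>2 * n + 2\<close> exceeds all columns, so
  the zigzag condition holds throughout.\<close>

lemma half_folded_Suc: "half_folded n c P (Suc n) = P \<union> zigzag n c"
proof -
  have "side c i \<in> {1, 2}" for i
    by (simp add: side_def)
  then show ?thesis
    by (auto simp: half_folded_def zigzag_def)
qed

lemma vtx_image:
  assumes "1 \<le> n"
  shows "vtx 0 c a ` {1..n} \<union> vtx 1 c b ` {1..n} = {a, b} \<union> zigzag n c"
proof (intro equalityI subsetI)
  fix u assume "u \<in> vtx 0 c a ` {1..n} \<union> vtx 1 c b ` {1..n}"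
  then obtain i where i: "1 \<le> i" "i \<le> n" "u = vtx 0 c a i \<or> u = vtx 1 c b i"
    by auto
  then show "u \<in> {a, b} \<union> zigzag n c"
    by (cases "i = 1") (auto simp: vtx_def zigzag_def)
next
  fix u assume "u \<in> {a, b} \<union> zigzag n c"
  then consider "u = a" | "u = b" | "u \<in> zigzag n c"
    by blast
  moreover have one: "1 \<in> {1..n}"
    using assms by simp
  ultimately show "u \<in> vtx 0 c a ` {1..n} \<union> vtx 1 c b ` {1..n}"
  proof cases
    case 1
    then have "u = vtx 0 c a 1"
      by (simp add: vtx_def)
    then show ?thesis
      using imageI[OF one, of "vtx 0 c a"] by (simp only: Un_iff simp_thms)
  next
    case 2
    then have "u = vtx 1 c b 1"
      by (simp add: vtx_def)
    then show ?thesis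
      using imageI[OF one, of "vtx 1 c b"] by (simp only: Un_iff simp_thms)
  next
    case 3
    obtain r where r: "u = (side c (r div 2), r)" "4 \<le> r" "r \<le> 2 * n + 1"
      using 3 by (auto simp: zigzag_def)
    define i where "i = r div 2"
    have i: "2 \<le> i" "i \<le> n" "r = 2 * i \<or> r = 2 * i + 1"
      using r unfolding i_def by linarith+
    then have "u = vtx 0 c a i \<or> u = vtx 1 c b i"
      using r(1) by (auto simp: vtx_def i_def[symmetric])
    then show ?thesis
      using i by auto
  qed
qed

text \<open>The special vertex \<open>a\<close> stays in the first three columns, while all other
  values lie in column 4 or later.\<close>

lemma inj_on_vtx:
  assumes "snd a \<le> 3"
  shows "inj_on (vtx k c a) {1..n}"
proof (rule inj_onI)
  fix i j assume "i \<in> {1..n}" "j \<in> {1..n}" "vtx k c a i = vtx k c a j"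
  then show "i = j"
    using assms by (cases "i = 1"; cases "j = 1") (auto simp: vtx_def)
qed

lemma vtx_disjoint:
  assumes "snd a \<le> 3" "snd b \<le> 3" "a \<noteq> b"
  shows "vtx 0 c a ` {1..n} \<inter> vtx 1 c b ` {1..n} = {}"
proof -
  have "vtx 0 c a i \<noteq> vtx 1 c b j" if "1 \<le> i" "1 \<le> j" for i j
  proof (cases "i = 1 \<or> j = 1")
    case True
    then show ?thesis
      using that assms by (cases "i = 1"; cases "j = 1") (auto simp: vtx_def)
  next
    case False
    have "2 * i \<noteq> 2 * j + 1"
      by presburger
    with False show ?thesis
      by (simp add: vtx_def)
  qed
  then show ?thesis
    by fastforce
qed

text \<open>The adjacent pairs in \<open>U\<close> are exactly the pairs \<open>p i\<close>,
  \<open>q i\<close>, so independence means containing no such pair entirely.\<close>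

lemma indep_eq_cross_polytope:
  assumes U: "U = p ` I \<union> q ` I"
    and "\<And>i. i \<in> I \<Longrightarrow> adj (p i) (q i)"
    and "\<And>u v. u \<in> U \<Longrightarrow> v \<in> U \<Longrightarrow> adj u v \<Longrightarrow> \<exists>i\<in>I. {u, v} = {p i, q i}"
  shows "indep U = cross_polytope I p q"
proof (intro set_eqI iffI)
  fix \<sigma> assume "\<sigma> \<in> indep U"
  then show "\<sigma> \<in> cross_polytope I p q"
    using assms(2) unfolding indep_def cross_polytope_def U by blast
next
  fix \<sigma> assume \<sigma>: "\<sigma> \<in> cross_polytope I p q"
  then have "\<sigma> \<subseteq> U"
    by (simp add: cross_polytope_def U)
  moreover have "\<not> adj u v" if uv: "u \<in> \<sigma>" "v \<in> \<sigma>" for u v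
  proof
    assume adj: "adj u v"
    have U': "u \<in> U" "v \<in> U"
      using uv[THEN subsetD[OF \<open>\<sigma> \<subseteq> U\<close>]] by simp_all
    from assms(3)[OF U' adj] obtain i where i: "i \<in> I" "{u, v} = {p i, q i}"
      by (rule bexE)
    have "{p i, q i} \<subseteq> \<sigma>"
      unfolding i(2)[symmetric] using uv by simp
    moreover have "p i \<notin> \<sigma> \<or> q i \<notin> \<sigma>"
      using \<sigma> i(1) unfolding cross_polytope_def by blast
    ultimately show False
      by simp
  qed
  ultimately show "\<sigma> \<in> indep U"
    by (simp add: indep_def)
qed

text \<open>The remaining graph consists of disjoint edges: \<open>a b\<close>, which
  \<open>sep\<close> keeps apart from the zigzag, and one edge in columns \<open>2 * i\<close> and
  \<open>2 * i + 1\<close> for each larger \<open>i\<close>.\<close>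

lemma indep_half_folded_Suc:
  assumes n: "1 \<le> n" and ab: "adj a b"
    and sep: "\<And>u v. u \<in> {a, b} \<Longrightarrow> v \<in> zigzag n c \<Longrightarrow> \<not> adj u v"
  shows "indep (half_folded n c {a, b} (Suc n)) = cross_polytope {1..n} (vtx 0 c a) (vtx 1 c b)"
  unfolding half_folded_Suc
proof (rule indep_eq_cross_polytope)
  show "{a, b} \<union> zigzag n c = vtx 0 c a ` {1..n} \<union> vtx 1 c b ` {1..n}"
    by (rule vtx_image[OF n, symmetric])
  show "adj (vtx 0 c a i) (vtx 1 c b i)" for i
    using ab by (simp add: vtx_def adj_simp)
  have zig: "\<exists>i\<in>{1..n}. {u, v} = {vtx 0 c a i, vtx 1 c b i}"
    if uv: "u \<in> zigzag n c" "v \<in> zigzag n c" "snd v = Suc (snd u)" "fst u = fst v" for u v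
  proof -
    obtain r where u: "u = (side c (r div 2), r)" "4 \<le> r" and v: "v = (side c (Suc r div 2), Suc r)" "Suc r \<le> 2 * n + 1"
      using uv by (auto simp: zigzag_def)
    \<comment> \<open>Between an odd column and the next even one the zigzag changes rows, so there
      is no horizontal edge.\<close>
    have "even r"
    proof (rule ccontr)
      assume "odd r"
      then have "Suc r div 2 = Suc (r div 2)"
        by presburger
      then show False
        using uv(4) side_cases[of c "r div 2"] by (auto simp: u v)
    qed
    then obtain i where "r = 2 * i"
      by (elim evenE)
    then have "u = vtx 0 c a i" "v = vtx 1 c b i" "i \<in> {1..n}"
      using u v by (auto simp: vtx_def)
    then show ?thesis
      by blast
  qed
  show "\<exists>i\<in>{1..n}. {u, v} = {vtx 0 c a i, vtx 1 c b i}"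
    if uv: "u \<in> {a, b} \<union> zigzag n c" "v \<in> {a, b} \<union> zigzag n c" "adj u v" for u v
  proof (cases "u \<in> zigzag n c \<and> v \<in> zigzag n c")
    case True
    \<comment> \<open>The zigzag has a single vertex in each column, so it contains no rung.\<close>
    have "fst u \<noteq> fst v \<and> snd u = snd v \<longrightarrow> False"
      using True by (auto simp: zigzag_def)
    then consider "snd v = Suc (snd u)" "fst u = fst v" | "snd u = Suc (snd v)" "fst v = fst u"
      using uv(3) unfolding adj_def by metis
    then show ?thesis
    proof cases
      case 1
      then show ?thesis
        using zig[of u v] True by blast
    next
      case 2
      then show ?thesis
        using zig[of v u] True by (simp add: insert_commute)
    qed
  next
    case False
    have "u \<in> {a, b} \<and> v \<in> {a, b}"
      using False uv sep adj_commute by blast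
    then have "{u, v} = {a, b}"
      using uv(3) adj_irrefl by blast
    then have "{u, v} = {vtx 0 c a 1, vtx 1 c b 1}"
      by (simp add: vtx_def)
    then show ?thesis
      using n by (intro bexI[of _ 1]) auto
  qed
qed


section \<open>The two cones for the row of hexagons\<close>

text \<open>Faces avoiding \<open>x\<close> and \<open>y\<close> are absorbed by the simplex on
  \<open>V\<close>; any other face contains exactly one of them and consists of that vertex and a
  face of its link, an independent set of non-neighbours. The extra vertex \<open>z\<close> enters
  only the simplex and later becomes the wedge point.\<close>

lemma indep_delete_edge_Un_Pow:
  assumes xy: "x \<in> H" "y \<in> H" "x \<noteq> y" and z: "z \<notin> H" and V: "V = insert z (H - {x, y})"
  shows "{\<sigma>\<in>indep H. \<not> {x, y} \<subseteq> \<sigma>} \<union> Pow V =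
    two_cones V x y (indep {u\<in>H - {x, y}. \<not> adj x u}) (indep {u\<in>H - {x, y}. \<not> adj y u})"
    (is "?K \<union> Pow V = two_cones V x y (indep (?U x)) (indep (?U y))")
proof (intro equalityI subsetI)
  have peel: "\<exists>\<tau>\<in>indep (?U v). \<sigma> = insert v \<tau>"
    if "\<sigma> \<in> indep H" "v \<in> \<sigma>" "\<sigma> \<inter> {x, y} \<subseteq> {v}" for \<sigma> v
  proof
    show "\<sigma> = insert v (\<sigma> - {v})"
      using that(2) by blast
    show "\<sigma> - {v} \<in> indep (?U v)"
      using that unfolding indep_def by blast
  qed
  fix \<sigma> assume "\<sigma> \<in> ?K \<union> Pow V"
  then consider "\<sigma> \<subseteq> V" | "\<sigma> \<in> ?K" "x \<in> \<sigma>" | "\<sigma> \<in> ?K" "y \<in> \<sigma>" | "\<sigma> \<in> ?K" "x \<notin> \<sigma>" "y \<notin> \<sigma>"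
    by blast
  then show "\<sigma> \<in> two_cones V x y (indep (?U x)) (indep (?U y))"
  proof cases
    case 1
    then show ?thesis
      by (rule two_conesI)
  next
    case 2
    then have "\<sigma> \<in> indep H" "\<sigma> \<inter> {x, y} \<subseteq> {x}"
      by blast+
    with peel[OF _ 2(2)] show ?thesis
      by (auto intro: two_conesI)
  next
    case 3
    then have "\<sigma> \<in> indep H" "\<sigma> \<inter> {x, y} \<subseteq> {y}"
      by blast+
    with peel[OF _ 3(2)] show ?thesis
      by (auto intro: two_conesI)
  next
    case 4
    then have "\<sigma> \<subseteq> V"
      unfolding V indep_def by blast
    then show ?thesis
      by (rule two_conesI)
  qed
next
  have attach: "insert v \<tau> \<in> ?K" if \<tau>: "\<tau> \<in> indep (?U v)" and v: "v \<in> {x, y}" for \<tau> v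
  proof -
    have sub: "\<tau> \<subseteq> H - {x, y}" and far: "\<And>u. u \<in> \<tau> \<Longrightarrow> \<not> adj v u"
      using \<tau> unfolding indep_def by blast+
    have "\<tau> \<in> indep H"
      using \<tau> unfolding indep_def by blast
    moreover have "v \<in> H"
      using v xy by blast
    ultimately have "insert v \<tau> \<in> indep H"
      using far by (rule indep_insert)
    moreover have "\<not> {x, y} \<subseteq> insert v \<tau>"
      using sub xy(3) by blast
    ultimately show ?thesis
      by (intro CollectI conjI)
  qed
  fix \<sigma> assume "\<sigma> \<in> two_cones V x y (indep (?U x)) (indep (?U y))"
  then show "\<sigma> \<in> ?K \<union> Pow V"
    by (cases rule: two_conesE) (use attach in blast)+
qed

text \<open>The neighbours \<open>(1, 2)\<close> and \<open>(2, 1)\<close> drop out, leaving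
  \<open>(2, 2)\<close> and \<open>(2, 3)\<close> in the first three columns. Stage 1 imposes no
  condition from column 4 on.\<close>

lemma link_first:
  assumes "1 \<le> n"
  shows "{u\<in>hex_line_verts n - {(1, 1), (1, 3)}. \<not> adj (1, 1) u} = half_folded n 0 {(2, 2), (2, 3)} 1"
proof -
  have "(j, r) \<in> hex_line_verts n - {(1, 1), (1, 3)} \<and> \<not> adj (1, 1) (j, r) \<longleftrightarrow>
      (j, r) \<in> half_folded n 0 {(2, 2), (2, 3)} 1" for j r
  proof -
    consider "r = 0" | "r = 1" | "r = 2" | "r = 3" | "4 \<le> r"
      by linarith
    then show ?thesis
      by cases (use assms in \<open>auto simp: hex_line_verts_def adj_simp mem_half_folded_iff\<close>)
  qed
  then show ?thesis
    by auto
qed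

text \<open>The neighbours \<open>(1, 2)\<close>, \<open>(2, 3)\<close> and, for
  \<open>n \<ge> 2\<close>, \<open>(1, 4)\<close> drop out. In column 4 only row 2 remains, in
  agreement with \<open>side 1 2 = 2\<close>, so the folding is already at stage 2.\<close>

lemma link_second:
  assumes "1 \<le> n"
  shows "{u\<in>hex_line_verts n - {(1, 1), (1, 3)}. \<not> adj (1, 3) u} = half_folded n 1 {(2, 1), (2, 2)} 2"
proof -
  have "(j, r) \<in> hex_line_verts n - {(1, 1), (1, 3)} \<and> \<not> adj (1, 3) (j, r) \<longleftrightarrow>
      (j, r) \<in> half_folded n 1 {(2, 1), (2, 2)} 2" for j r
  proof (cases "5 \<le> r")
    case True
    then show ?thesis
      by (auto simp: hex_line_verts_def adj_simp mem_half_folded_iff)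
  next
    case False
    then consider "r = 0" | "r = 1" | "r = 2" | "r = 3" | "r = 4"
      by linarith
    moreover have "side 1 2 = 2"
      by (simp add: side_def)
    ultimately show ?thesis
      using assms
      by cases (simp_all add: hex_line_verts_def adj_simp mem_half_folded_iff, linarith+)
  qed
  then show ?thesis
    by auto
qed

theorem theorem3p1:
  fixes n :: nat
  assumes "n \<ge> 1"
  shows "geometric_realization (independence_complex (hex_line_verts n) (hex_line_edges n))
           homotopy_equivalent_space wedge_of_spheres 2 n"
proof -
  let ?H = "hex_line_verts n"
  let ?x = "(1, 1) :: nat \<times> nat" and ?y = "(1, 3) :: nat \<times> nat"
  \<comment> \<open>\<open>?z\<close> is a new vertex outside the graph, reserved for the wedge
    point; \<open>?s\<close> is the common neighbour of \<open>?x\<close> and \<open>?y\<close>, and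
    \<open>?w\<close> lies opposite \<open>?s\<close> in the first hexagon.\<close>
  let ?s = "(1, 2) :: nat \<times> nat" and ?z = "(0, 0) :: nat \<times> nat" and ?w = "(2, 2) :: nat \<times> nat"
  define V where "V = insert ?z (?H - {?x, ?y})"
  define K where "K = {\<sigma>\<in>indep ?H. \<not> {?x, ?y} \<subseteq> \<sigma>}"
  have H: "?x \<in> ?H" "?y \<in> ?H" "?s \<in> ?H" "?w \<in> ?H" "?z \<notin> ?H" "finite ?H"
    using assms by (auto simp: hex_line_verts_def)
  have V: "finite V" "?x \<notin> V" "?y \<notin> V" "?z \<in> V" "?s \<in> V"
    using H by (auto simp: V_def)
  have rows: "{1, 2} \<times> {4..2 * n + 1} \<subseteq> V"
    by (auto simp: V_def hex_line_verts_def)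
  have zigzag_V: "zigzag n c \<subseteq> V - {?z}" for c
  proof -
    have "zigzag n c \<subseteq> {1, 2} \<times> {4..2 * n + 1} - {?z}"
      by (auto simp: zigzag_def side_def)
    with rows show ?thesis
      by blast
  qed
  have indep_H: "simplicial (indep ?H)"
    using subcomplex_indep[OF H(6) order_refl] by (simp add: subcomplex_def)
  \<comment> \<open>The neighbours of \<open>?w\<close> are \<open>(2, 1)\<close> and
    \<open>(2, 3)\<close>, joined by rungs to \<open>?x\<close> and \<open>?y\<close>. So
    \<open>?w\<close> extends every face containing both, and all these faces can be
    removed.\<close>
  have "geometric_realization (indep ?H) homotopy_equivalent_space geometric_realization K"
    unfolding K_def
  proof (rule homotopy_equivalent_collapse[OF indep_H])
    fix \<sigma> assume \<sigma>: "\<sigma> \<in> indep ?H" "{?x, ?y} \<subseteq> \<sigma>"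
    have "\<not> adj ?w u" if u: "u \<in> \<sigma>" for u
    proof
      assume "adj ?w u"
      moreover have "u \<in> {1, 2} \<times> UNIV"
        using u \<sigma>(1) by (auto simp: indep_def hex_line_verts_def)
      ultimately have "adj ?x u \<or> adj ?y u"
        by (auto simp: adj_simp)
      then show False
        using \<sigma> u unfolding indep_def by blast
    qed
    then show "insert ?w \<sigma> \<in> indep ?H"
      by (rule indep_insert[OF \<sigma>(1) H(4)])
  qed auto
  \<comment> \<open>The only neighbours of \<open>?s\<close> are \<open>?x\<close> and
    \<open>?y\<close>, so the faces of \<open>K\<close> inside \<open>V\<close> form a cone with
    apex \<open>?s\<close>.\<close>
  also have "geometric_realization K homotopy_equivalent_space geometric_realization (K \<union> Pow V)"
  proof (rule homotopy_equivalent_Un_Pow[OF _ _ V(1,5)])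
    show "simplicial K"
      using indep_H unfolding simplicial_def K_def by blast
    show "{} \<in> K"
      by (simp add: K_def indep_def)
    fix \<sigma> assume \<sigma>: "\<sigma> \<in> K" "\<sigma> \<subseteq> V"
    have "\<not> adj ?s u" if u: "u \<in> \<sigma>" for u
    proof -
      have "u \<in> ?H - {?x, ?y}"
        using u \<sigma> H(5) by (auto simp: K_def V_def indep_def)
      then show ?thesis
        by (auto simp: adj_def prod_eq_iff)
    qed
    then have "insert ?s \<sigma> \<in> indep ?H"
      using \<sigma>(1) H(3) by (intro indep_insert) (auto simp: K_def)
    moreover have "?x \<notin> insert ?s \<sigma>"
      using \<sigma>(2) V(2) by auto
    ultimately show "insert ?s \<sigma> \<in> K"
      by (simp add: K_def)
  qed
  also have "K \<union> Pow V = two_cones V ?x ?y (indep (half_folded n 0 {(2, 2), (2, 3)} 1))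
      (indep (half_folded n 1 {(2, 1), (2, 2)} 2))"
    unfolding K_def link_first[OF assms, symmetric] link_second[OF assms, symmetric]
    by (rule indep_delete_edge_Un_Pow[OF H(1,2) _ H(5) V_def]) simp
  also have "geometric_realization (two_cones V ?x ?y (indep (half_folded n 0 {(2, 2), (2, 3)} 1))
        (indep (half_folded n 1 {(2, 1), (2, 2)} 2))) homotopy_equivalent_space
      geometric_realization (two_cones V ?x ?y
        (cross_polytope {1..n} (vtx 0 0 (2, 2)) (vtx 1 0 (2, 3)))
        (cross_polytope {1..n} (vtx 0 1 (2, 1)) (vtx 1 1 (1, 2))))"
  proof (rule two_cones_homotopy_equivalent[OF V(2,3)])
    show "?x \<noteq> ?y"
      by simp
    have P1: "{(2, 2), (2, 3)} \<subseteq> V" and P2: "{(2, 1), (2, 2)} \<subseteq> V"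
      using assms by (auto simp: V_def hex_line_verts_def)
    have final1: "indep (half_folded n 0 {(2, 2), (2, 3)} (Suc n)) =
        cross_polytope {1..n} (vtx 0 0 (2, 2)) (vtx 1 0 (2, 3))"
      by (rule indep_half_folded_Suc[OF assms]) (auto simp: adj_simp zigzag_def side_def)
    have final2: "indep (half_folded n 1 {(2, 1), (2, 2)} (Suc n)) =
        cross_polytope {1..n} (vtx 0 1 (2, 1)) (vtx 1 1 (2, 2))"
      by (rule indep_half_folded_Suc[OF assms]) (auto simp: adj_simp zigzag_def side_def)
    show "subcomplex V (cross_polytope {1..n} (vtx 0 0 (2, 2)) (vtx 1 0 (2, 3)))"
      unfolding final1[symmetric] half_folded_Suc
      using P1 zigzag_V by (intro subcomplex_indep V(1)) blast
    show "subcomplex V (indep (half_folded n 1 {(2, 1), (2, 2)} 2))"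
      unfolding link_second[OF assms, symmetric]
      by (intro subcomplex_indep V(1)) (auto simp: V_def)
    show "link_equiv V (indep (half_folded n 0 {(2, 2), (2, 3)} 1))
        (cross_polytope {1..n} (vtx 0 0 (2, 2)) (vtx 1 0 (2, 3)))"
      unfolding final1[symmetric]
    proof (rule link_equiv_half_folded[OF V(1) P1 rows])
      fix u :: "nat \<times> nat" and m :: nat
      assume m: "1 \<le> m" and u: "u \<in> {(2, 2), (2, 3)}" and adj: "adj (side 0 m, 2 * m) u"
      \<comment> \<open>Only the first fold, onto \<open>(2, 2)\<close>, meets a neighbour in
        \<open>P\<close>, namely \<open>(2, 3)\<close>. For \<open>m = 2\<close> the vertex folded
        onto is \<open>(1, 4)\<close> in the other row, and later ones are too far away.\<close>
      have "m = 1"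
      proof (rule ccontr)
        assume "m \<noteq> 1"
        then consider "m = 2" | "3 \<le> m"
          using m by linarith
        then show False
          using u adj by cases (auto simp: adj_simp side_def)
      qed
      then show "adj (3 - side 0 m, Suc (2 * m)) u \<and> adj (side 0 m, 2 * m + 2) u"
        using u adj by (auto simp: adj_simp side_def)
    qed (use assms in \<open>auto simp: side_def\<close>)
    \<comment> \<open>From stage 2 on, the vertices folded onto lie in column 4 or later and have no
      neighbour among \<open>(2, 1)\<close> and \<open>(2, 2)\<close>.\<close>
    have "link_equiv V (indep (half_folded n 1 {(2, 1), (2, 2)} 2))
        (cross_polytope {1..n} (vtx 0 1 (2, 1)) (vtx 1 1 (2, 2)))"
      unfolding final2[symmetric]
      by (rule link_equiv_half_folded[OF V(1) P2 rows])
        (use assms in \<open>auto simp: side_def adj_simp\<close>)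
    \<comment> \<open>The vertex \<open>(2, 2)\<close> occurs in both cross-polytope boundaries. Its
      replacement \<open>?s\<close> occurs in neither, which makes their vertex sets
      disjoint.\<close>
    also have "link_equiv V (cross_polytope {1..n} (vtx 0 1 (2, 1)) (vtx 1 1 (2, 2)))
        (cross_polytope {1..n} (vtx 0 1 (2, 1)) ((vtx 1 1 (2, 2))(1 := ?s)))"
    proof (rule link_equiv_replace_vertex[OF V(1) _ _ V(5)])
      show "vtx 0 1 (2, 1) ` {1..n} \<union> vtx 1 1 (2, 2) ` {1..n} \<subseteq> V"
        unfolding vtx_image[OF assms] using P2 zigzag_V by blast
      show "?s \<notin> vtx 0 1 (2, 1) ` {1..n} \<union> vtx 1 1 (2, 2) ` {1..n}"
        unfolding vtx_image[OF assms] by (simp add: zigzag_def)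
      have "vtx 0 1 (2, 1) ` {1..n} \<inter> vtx 1 1 (2, 2) ` {1..n} = {}"
        by (rule vtx_disjoint) simp_all
      moreover have "vtx 1 1 (2, 2) 1 \<in> vtx 1 1 (2, 2) ` {1..n}"
        using assms by (intro imageI) simp
      ultimately show "vtx 1 1 (2, 2) 1 \<notin> vtx 0 1 (2, 1) ` {1..n}"
        by blast
      show "inj_on (vtx 1 1 (2, 2)) {1..n}"
        by (rule inj_on_vtx) simp
    qed (use assms in auto)
    also have "(vtx 1 1 (2, 2))(1 := ?s) = vtx 1 1 ?s"
      by (auto simp: vtx_def)
    finally show "link_equiv V (indep (half_folded n 1 {(2, 1), (2, 2)} 2))
        (cross_polytope {1..n} (vtx 0 1 (2, 1)) (vtx 1 1 (1, 2)))" .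
  qed
  also have "\<dots> homotopy_equivalent_space wedge_of_spheres 2 n"
  proof (rule two_cones_cross_polytopes[OF V(1,2,3) _ V(4)])
    have base: "{(2, 2), (2, 3)} \<subseteq> V - {?z}" "{(2, 1), ?s} \<subseteq> V - {?z}"
      using assms by (auto simp: V_def hex_line_verts_def)
    show "vtx 0 0 (2, 2) ` {1..n} \<union> vtx 1 0 (2, 3) ` {1..n} \<subseteq> V - {?z}"
      unfolding vtx_image[OF assms] using base(1) zigzag_V by blast
    show "vtx 0 1 (2, 1) ` {1..n} \<union> vtx 1 1 ?s ` {1..n} \<subseteq> V - {?z}"
      unfolding vtx_image[OF assms] using base(2) zigzag_V by blast
    show "(vtx 0 0 (2, 2) ` {1..n} \<union> vtx 1 0 (2, 3) ` {1..n}) \<inter>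
        (vtx 0 1 (2, 1) ` {1..n} \<union> vtx 1 1 ?s ` {1..n}) = {}"
      unfolding vtx_image[OF assms] by (auto simp: zigzag_def side_def split: if_splits)
  qed (simp_all add: inj_on_vtx vtx_disjoint del: One_nat_def)
  finally show ?thesis
    unfolding independence_complex_hex_line .
qed

end
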